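(* Assume that $(q,\underline Q)$ is separate with respect to every $\underline\mu\in\mathscr P^{\bullet,m}_{n+1}$, and let $\underline\lambda\in\mathscr P^{\bullet,m}_n$. The simple $\mathcal H_c^f(n)$-supermodule $\mathbb D(\underline\lambda)$ has a $\mathbb K$-basis $$\bigsqcup_{\mathfrak t\in \mathrm{Std}(\underline\lambda)}\{C^{\beta}C^{\alpha}v_{\mathfrak t}\mid \beta\in\mathbb Z_2([n]\setminus\mathcal D_{\mathfrak t}),\ \alpha\in\mathbb Z_2(\mathcal{OD}_{\mathfrak t})\}.$$ Moreover, for $\mathfrak t\in\mathrm{Std}(\underline\lambda)$, $\beta\in\mathbb Z_2([n]\setminus\mathcal D_{\mathfrak t})$, $\alpha\in\mathbb Z_2(\mathcal{OD}_{\mathfrak t})$ (writing $x_p=x_p(\mathfrak t)$) the generators act as follows. (1) For $i\in[n]$: $X_i\cdot C^\beta C^\alpha v_{\mathfrak t}=\mathtt b_{\mathfrak t,i}^{-\nu_\beta(i)}C^\beta C^\alpha v_{\mathfrak t}$. (2) For $i\in[n]$: $$C_i\cdot C^\beta C^\alpha v_{\mathfrak t}=\begin{cases}(-1)^{|\beta|_{<i}}C^{\beta+e_i}C^\alpha v_{\mathfrak t}, & i\notin\mathcal D_{\mathfrak t},\\ (-1)^{|\beta|+|\alpha|_{<i}}C^\beta C^{\alpha+e_i}v_{\mathfrak t}, & i=x_p,\ p\text{ odd},\\ (-\sqrt{-1})(-1)^{|\beta|+|\alpha|_{\le x_{p-1}}}C^\beta C^{\alpha+e_{x_{p-1}}}v_{\mathfrak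 t}, & i=x_p,\ p\text{ even}.\end{cases}$$ (3) For $i\in[n-1]$: $$T_i\cdot C^\beta C^\alpha v_{\mathfrak t}=-\frac{\epsilon}{\mathtt b_{\mathfrak t,i}^{-\nu_\beta(i)}\mathtt b_{\mathfrak t,i+1}^{\nu_\beta(i+1)}-1}C^\beta C^\alpha v_{\mathfrak t}+\frac{\epsilon}{\mathtt b_{\mathfrak t,i}^{\nu_\beta(i)}\mathtt b_{\mathfrak t,i+1}^{\nu_\beta(i+1)}-1}R+\delta(s_i\mathfrak t)(-1)^{\delta_\beta(i)\delta_\beta(i+1)+\delta_\alpha(i)\delta_\alpha(i+1)}\sqrt{\mathtt c_{\mathfrak t}(i)}\,C^{s_i\cdot\beta}C^{s_i\cdot\alpha}v_{s_i\mathfrak t},$$ where $R=R(i,\beta,\alpha,\mathfrak t)$ is: (i) if $i,i+1\notin\mathcal D_{\mathfrak t}$: $R=(-1)^{\delta_\beta(i)}C^{\beta+e_i+e_{i+1}}C^\alpha v_{\mathfrak t}$; (ii) if $i=x_p\in\mathcal D_{\mathfrak t}$, $i+1\notin\mathcal D_{\mathfrak t}$: $R=(-1)^{|\beta|_{>i}+|\alpha|_{<i}}C^{\beta+e_{i+1}}C^{\alpha+e_i}v_{\mathfrak t}$ for $p$ odd, and $R=(-\sqrt{-1})(-1)^{|\beta|_{>i}+|\alpha|_{\le x_{p-1}}}C^{\beta+e_{i+1}}C^{\alpha+e_{x_{p-1}}}v_{\mathfrak t}$ for $p$ even; (iii) if $i\notin\mathcal D_{\mathfrak t}$, $i+1=x_p\in\mathcal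 D_{\mathfrak t}$: $R=(-1)^{|\beta|_{\ge i}+|\alpha|_{<i+1}}C^{\beta+e_i}C^{\alpha+e_{i+1}}v_{\mathfrak t}$ for $p$ odd, and $R=(-\sqrt{-1})(-1)^{|\beta|_{\ge i}+|\alpha|_{\le x_{p-1}}}C^{\beta+e_i}C^{\alpha+e_{x_{p-1}}}v_{\mathfrak t}$ for $p$ even; (iv) if $i=x_p$, $i+1=x_{p'}$ are both in $\mathcal D_{\mathfrak t}$: $$R=\begin{cases}(-1)^{\delta_\alpha(i)}C^\beta C^{\alpha+e_i+e_{i+1}}v_{\mathfrak t}, & p,p'\text{ odd},\\ (-\sqrt{-1})(-1)^{|\alpha|_{<i+1}+|\alpha+e_{i+1}|_{\le x_{p-1}}}C^\beta C^{\alpha+e_{x_{p-1}}+e_{i+1}}v_{\mathfrak t}, & p\text{ even},\ p'\text{ odd},\\ (-\sqrt{-1})(-1)^{|\alpha|_{\le x_{p'-1}}+|\alpha+e_{x_{p'-1}}|_{<i}}C^\beta C^{\alpha+e_i+e_{x_{p'-1}}}v_{\mathfrak t}, & p\text{ odd},\ p'\text{ even},\\ (-1)^{1+|\alpha|_{\le x_{p'-1}}+|\alpha+e_{x_{p'-1}}|_{\le x_{p-1}}}C^\beta C^{\alpha+e_{x_{p-1}}+e_{x_{p'-1}}}v_{\mathfrak t}, & p,p'\text{ even}.\end{cases}$$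
   Context: **Algebra.** $\mathbb K$ is an algebraically closed field of characteristic $\ne2$; for every $a\in\mathbb K$ a square root $\sqrt a$ is fixed once and for all. $n\ge1$, $[n]=\{1,\dots,n\}$; $q\in\mathbb K^*$ with $q^2\ne\pm1$, $\epsilon=q-q^{-1}$. For $\iota\in\mathbb K^*$: $\mathtt q(\iota)=2\frac{q\iota+(q\iota)^{-1}}{q+q^{-1}}$, $\mathtt b_\pm(\iota)=\frac{\mathtt q(\iota)}2\pm\sqrt{\frac{\mathtt q(\iota)^2}4-1}$ (so $\mathtt b_+\mathtt b_-=1$). $\mathcal H_c(n)$ is the $\mathbb K$-superalgebra with even generators $T_1,\dots,T_{n-1},X_1^{\pm1},\dots,X_n^{\pm1}$, odd generators $C_1,\dots,C_n$ and relations: $T_i^2=\epsilon T_i+1$; $T_iT_j=T_jT_i$ ($|i-j|>1$); $T_iT_{i+1}T_i=T_{i+1}T_iT_{i+1}$; $X_iX_j=X_jX_i$; $X_iX_i^{-1}=X_i^{-1}X_i=1$; $C_i^2=1$; $C_iC_j=-C_jC_i$ ($i\ne j$); $T_iX_i=X_{i+1}T_i-\epsilon(X_{i+1}+C_iC_{i+1}X_i)$; $T_iX_{i+1}=X_iT_i+\epsilon(1-C_iC_{i+1})X_{i+1}$; $T_iX_j=X_jT_i$ ($j\ne i,i+1$); $T_iC_i=C_{i+1}T_i$; $T_iC_{i+1}=C_iT_i-\epsilon(C_i-C_{i+1})$; $T_iC_j=C_jT_i$ ($j\neq i,i+1$); $X_iC_i=C_iX_i^{-1}$; $X_iC_j=C_jX_i$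 ($i\ne j$). Fix $m\ge0$, $\underline Q=(Q_1,\dots,Q_m)\in(\mathbb K^* )^m$, $\bullet\in\{\mathsf 0,\mathsf s,\mathsf{ss}\}$, and $f=g\cdot\prod_{i=1}^m(X_1+X_1^{-1}-\mathtt q(Q_i))$ with $g=1,\ X_1-1,\ (X_1-1)(X_1+1)$ for $\bullet=\mathsf0,\mathsf s,\mathsf{ss}$ respectively. $\mathcal H_c^f(n)$ is the quotient of $\mathcal H_c(n)$ by the two-sided ideal generated by $f$. **Combinatorics.** $\mathscr P^{\bullet,m}_n$ is the set of tuples $\underline\lambda$ of total size $n$: $(\lambda^{(1)},\dots,\lambda^{(m)})$ for $\bullet=\mathsf0$, $(\lambda^{(0)},\lambda^{(1)},\dots,\lambda^{(m)})$ for $\bullet=\mathsf s$, $(\lambda^{(0_-)},\lambda^{(0_+)},\lambda^{(1)},\dots,\lambda^{(m)})$ for $\bullet=\mathsf{ss}$, where $\lambda^{(1)},\dots,\lambda^{(m)}$ are partitions (Young diagrams) and $\lambda^{(0)},\lambda^{(0_\pm)}$ are strict partitions (shifted Young diagrams: row $i$ starts in column $i$). Boxes are written $(i,j,l)$ (row, column, component). $\mathrm{Std}(\underline\lambda)$ is the set of standard tableaux, i.e. bijections $\underline\lambda\to[n]$ increasing along rows and down columns of each component; $\mathfrak S_n$ (with simple transpositions $s_i$) acts on tableaux by permuting entries; $\mathfrak t^{\underline\lambda}$ is obtained by inserting $1,\dots,n$ consecutively by rows starting from the first component; $d(\mathfrak s,\mathfrak t)\in\mathfrak S_n$ is the element with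 $\mathfrak s=d(\mathfrak s,\mathfrak t)\mathfrak t$. $\mathcal D_{\underline\lambda}$ is the set of boxes $(a,a,l)$ of the strict components ($\emptyset$ if $\bullet=\mathsf0$), $t=\#\mathcal D_{\underline\lambda}$, $\mathcal D_{\mathfrak t}=\mathfrak t(\mathcal D_{\underline\lambda})$. Write $\mathcal D_{\mathfrak t^{\underline\lambda}}=\{i_1<\dots<i_t\}$ and $x_p(\mathfrak t)=d(\mathfrak t,\mathfrak t^{\underline\lambda})(i_p)$, so $\mathcal D_{\mathfrak t}=\{x_1(\mathfrak t),\dots,x_t(\mathfrak t)\}$; $\mathcal{OD}_{\mathfrak t}=\{x_p(\mathfrak t): p\text{ odd}\}$. With $Q_0=Q_{0_+}=1$, $Q_{0_-}=-1$, $\mathrm{res}_{\mathfrak t}(k)=Q_lq^{2(j-i)}$ if $\mathfrak t(i,j,l)=k$. $(q,\underline Q)$ is *separate* with respect to $\underline\mu\in\mathscr P^{\bullet,m}_{N}$ if $\mathtt q(\mathrm{res}_{\mathfrak u}(k))\ne\mathtt q(\mathrm{res}_{\mathfrak u}(k+1))$ for all $\mathfrak u\in\mathrm{Std}(\underline\mu)$ and $1\le k\le N-1$. For $\beta\in\mathbb Z_2^n$: $\mathrm{supp}(\beta)=\{k:\beta_k=\bar1\}$, $C^\beta=C_1^{\beta_1}\cdots C_n^{\beta_n}$, $|\beta|=\sum_k\beta_k$, $|\beta|_{<i}=\sum_{k<i}\beta_k$ (similarly $\le,>,\ge$), $e_k$ the standard vectors, $\nu_\beta(i)=(-1)^{\beta_i}$,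 $\delta_\beta(i)\in\{0,1\}$ equal to $1$ iff $\beta_i=\bar1$; $s_i\cdot\beta$ swaps entries $i,i+1$. For a subset $A\subseteq [n]$, $\mathbb Z_2(A)=\{\beta\in\mathbb Z_2^n:\mathrm{supp}(\beta)\subseteq A\}$. **Module.** $\mathtt b_{\mathfrak t,i}=\mathtt b_-(\mathrm{res}_{\mathfrak t}(i))$; $\delta(s_i\mathfrak t)=1$ if $s_i\mathfrak t$ is standard, else $0$; $\mathtt c_{\mathfrak t}(i)=1-\epsilon^2\Bigl(\frac{\mathtt b_{\mathfrak t,i}^{-1}\mathtt b_{\mathfrak t,i+1}}{(\mathtt b_{\mathfrak t,i}^{-1}\mathtt b_{\mathfrak t,i+1}-1)^2}+\frac{\mathtt b_{\mathfrak t,i}\mathtt b_{\mathfrak t,i+1}}{(\mathtt b_{\mathfrak t,i}\mathtt b_{\mathfrak t,i+1}-1)^2}\Bigr)$; $\gamma_{\mathfrak t}=2^{-\lfloor t/2\rfloor}\prod_{k=1}^{\lfloor t/2\rfloor}(1+\sqrt{-1}\,C_{x_{2k-1}(\mathfrak t)}C_{x_{2k}(\mathfrak t)})$. Let $\mathcal A_n$ be the superalgebra with even generators $X_1^{\pm1},\dots,X_n^{\pm1}$ and odd generators $C_1,\dots,C_n$ subject to the relations $X_iX_j=X_jX_i$; $X_iX_i^{-1}=X_i^{-1}X_i=1$; $C_i^2=1$; $C_iC_j=-C_jC_i$ ($i\ne j$); $X_iC_i=C_iX_i^{-1}$; $X_iC_j=C_jX_i$ ($i\ne j$). Let $M$ be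 the $\mathcal A_n$-supermodule with basis $\{C^\beta v\mid\beta\in\mathbb Z_2^n\}$, $v$ even, $X_i^{\pm1}v=\mathtt b_\pm(\mathrm{res}_{\mathfrak t^{\underline\lambda}}(i))v$. Put $v_{\mathfrak t^{\underline\lambda}}=\gamma_{\mathfrak t^{\underline\lambda}}v$ and $L=\mathcal A_nv_{\mathfrak t^{\underline\lambda}}\subseteq M$ (an irreducible $\mathcal A_n$-supermodule). For $\tau\in\mathfrak S_n$, $L^\tau=\{z^\tau\mid z\in L\}$ with $X_{\tau(k)}^{\pm1}z^\tau=(X_k^{\pm1}z)^\tau$, $C_{\tau(k)}z^\tau=(C_kz)^\tau$. Then $\mathbb D(\underline\lambda)=\bigoplus_{\mathfrak t\in\mathrm{Std}(\underline\lambda)}L^{d(\mathfrak t,\mathfrak t^{\underline\lambda})}$, $v_{\mathfrak t}=(v_{\mathfrak t^{\underline\lambda}})^{d(\mathfrak t,\mathfrak t^{\underline\lambda})}$, and for $z\in L$, $d=d(\mathfrak t,\mathfrak t^{\underline\lambda})$, $$T_iz^{d}=\Bigl(-\frac{\epsilon}{X_iX_{i+1}^{-1}-1}+\frac{\epsilon}{X_iX_{i+1}-1}C_iC_{i+1}\Bigr)z^{d}+\delta(s_i\mathfrak t)\sqrt{\mathtt c_{\mathfrak t}(i)}\,z^{s_id}.$$ Under the separate hypothesis this is known to be a well-defined simple $\mathcal H_c^f(n)$-supermodule.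
   Formalization: In (3)(ii) the sign of R is corrected: the exponents are |β|_{>i}+1+|α|_{<i} (p odd) and |β|_{>i}+1+|α|_{≤x_{p-1}} (p even). The printed sign contradicts (2): for •=s, m=0, λ^(0)=(2), C_1C_2v_t = -C_2C_1v_t. *)

theory Defs
  imports
    "HOL-Computational_Algebra.Polynomial"
    "HOL-Combinatorics.Permutations"
    "HOL-Library.Function_Algebras"
    "HOL-Library.Z2"
begin

section \<open>Scalars\<close>

text \<open>
  Throughout, \<open>rt\<close> is the square root function fixed once and for all, and \<open>Q i\<close> for
  \<open>1 \<le> i \<le> m\<close> are the parameters \<open>Q\<^sub>1, \<dots>, Q\<^sub>m\<close>.
\<close>

definition eps :: "'k::field \<Rightarrow> 'k" where
  "eps q = q - inverse q"

definition qfun :: "'k::field \<Rightarrow> 'k \<Rightarrow> 'k" where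
  "qfun q a = 2 * ((q * a + inverse (q * a)) / (q + inverse q))"

definition b_plus :: "'k::field \<Rightarrow> ('k \<Rightarrow> 'k) \<Rightarrow> 'k \<Rightarrow> 'k" where
  "b_plus q rt a = qfun q a / 2 + rt ((qfun q a)\<^sup>2 / 4 - 1)"

definition b_minus :: "'k::field \<Rightarrow> ('k \<Rightarrow> 'k) \<Rightarrow> 'k \<Rightarrow> 'k" where
  "b_minus q rt a = qfun q a / 2 - rt ((qfun q a)\<^sup>2 / 4 - 1)"

section \<open>Multipartitions and standard tableaux\<close>

datatype bullet = Bullet_0 | Bullet_s | Bullet_ss

datatype comp = Zero | Zero_minus | Zero_plus | Level nat

fun comps :: "bullet \<Rightarrow> nat \<Rightarrow> comp set" where
  "comps Bullet_0 m = Level ` {1..m}"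
| "comps Bullet_s m = {Zero} \<union> Level ` {1..m}"
| "comps Bullet_ss m = {Zero_minus, Zero_plus} \<union> Level ` {1..m}"

text \<open>Position of a component in the tuple; \<open>Zero\<close> occurs only for \<open>Bullet_s\<close>, where
  \<open>Zero_minus\<close> and \<open>Zero_plus\<close> are absent.\<close>

fun comp_rank :: "comp \<Rightarrow> nat" where
  "comp_rank Zero = 0"
| "comp_rank Zero_minus = 0"
| "comp_rank Zero_plus = 1"
| "comp_rank (Level l) = Suc l"

fun strict_comp :: "comp \<Rightarrow> bool" where
  "strict_comp (Level l) = False"
| "strict_comp _ = True"

fun Qval :: "(nat \<Rightarrow> 'k::field) \<Rightarrow> comp \<Rightarrow> 'k" where
  "Qval Q Zero = 1"
| "Qval Q Zero_minus = -1"
| "Qval Q Zero_plus = 1"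
| "Qval Q (Level l) = Q l"

type_synonym mpart = "comp \<Rightarrow> nat list"

type_synonym box = "nat \<times> nat \<times> comp"

type_synonym tableau = "box \<Rightarrow> nat"

definition is_partition :: "nat list \<Rightarrow> bool" where
  "is_partition xs \<longleftrightarrow> sorted_wrt (\<ge>) xs \<and> 0 \<notin> set xs"

definition is_strict_partition :: "nat list \<Rightarrow> bool" where
  "is_strict_partition xs \<longleftrightarrow> sorted_wrt (>) xs \<and> 0 \<notin> set xs"

definition mparts :: "bullet \<Rightarrow> nat \<Rightarrow> nat \<Rightarrow> mpart set" where
  "mparts bul m n = {lam.
     (\<forall>l. l \<notin> comps bul m \<longrightarrow> lam l = []) \<and>
     (\<forall>l\<in>comps bul m. if strict_comp l then is_strict_partition (lam l) else is_partition (lam l)) \<and>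
     (\<Sum>l\<in>comps bul m. sum_list (lam l)) = n}"

definition boxes :: "mpart \<Rightarrow> box set" where
  "boxes lam = {(i, j, l). 1 \<le> i \<and> i \<le> length (lam l) \<and>
     (if strict_comp l then i \<le> j \<and> j < i + lam l ! (i - 1)
      else 1 \<le> j \<and> j \<le> lam l ! (i - 1))}"

abbreviation msize :: "mpart \<Rightarrow> nat" where
  "msize lam \<equiv> card (boxes lam)"

text \<open>A tableau is set to \<open>0\<close> outside the diagram, so that \<open>Std lam\<close> is a finite set and
  is compatible with permuting the entries \<open>1, \<dots>, n\<close>.\<close>

definition Std :: "mpart \<Rightarrow> tableau set" where
  "Std lam = {t. bij_betw t (boxes lam) {1..msize lam} \<and> (\<forall>x. x \<notin> boxes lam \<longrightarrow> t x = 0) \<and>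
     (\<forall>i j j' l. (i, j, l) \<in> boxes lam \<and> (i, j', l) \<in> boxes lam \<and> j < j'
        \<longrightarrow> t (i, j, l) < t (i, j', l)) \<and>
     (\<forall>i i' j l. (i, j, l) \<in> boxes lam \<and> (i', j, l) \<in> boxes lam \<and> i < i'
        \<longrightarrow> t (i, j, l) < t (i', j, l))}"

definition swap_tab :: "nat \<Rightarrow> tableau \<Rightarrow> tableau" where
  "swap_tab i t = transpose i (Suc i) \<circ> t"

fun reads_before :: "box \<Rightarrow> box \<Rightarrow> bool" where
  "reads_before (i, j, l) (i', j', l') \<longleftrightarrow>
     comp_rank l < comp_rank l' \<or> l = l' \<and> (i < i' \<or> i = i' \<and> j \<le> j')"

definition tab_init :: "mpart \<Rightarrow> tableau" where
  "tab_init lam x =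
     (if x \<in> boxes lam then card {y \<in> boxes lam. reads_before y x} else 0)"

text \<open>\<open>dperm lam s t\<close> is the permutation \<open>d(s, t)\<close> with \<open>s = d(s, t) t\<close>.\<close>

definition dperm :: "mpart \<Rightarrow> tableau \<Rightarrow> tableau \<Rightarrow> nat \<Rightarrow> nat" where
  "dperm lam s t = (THE d. d permutes {1..msize lam} \<and> s = d \<circ> t)"

definition diag_boxes :: "mpart \<Rightarrow> box set" where
  "diag_boxes lam = {(i, j, l) \<in> boxes lam. strict_comp l \<and> i = j}"

abbreviation num_diag :: "mpart \<Rightarrow> nat" where
  "num_diag lam \<equiv> card (diag_boxes lam)"

definition Dtab :: "mpart \<Rightarrow> tableau \<Rightarrow> nat set" where
  "Dtab lam t = t ` diag_boxes lam"

definition xp :: "mpart \<Rightarrow> tableau \<Rightarrow> nat \<Rightarrow> nat" where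
  "xp lam t p =
     dperm lam t (tab_init lam) (sorted_list_of_set (Dtab lam (tab_init lam)) ! (p - 1))"

definition ODtab :: "mpart \<Rightarrow> tableau \<Rightarrow> nat set" where
  "ODtab lam t = {xp lam t p | p. p \<in> {1..num_diag lam} \<and> odd p}"

definition res :: "'k::field \<Rightarrow> (nat \<Rightarrow> 'k) \<Rightarrow> mpart \<Rightarrow> tableau \<Rightarrow> nat \<Rightarrow> 'k" where
  "res q Q lam t k =
     (case inv_into (boxes lam) t k of (i, j, l) \<Rightarrow> Qval Q l * q powi (2 * (int j - int i)))"

definition separate :: "'k::field \<Rightarrow> (nat \<Rightarrow> 'k) \<Rightarrow> mpart \<Rightarrow> bool" where
  "separate q Q mu \<longleftrightarrow> (\<forall>u\<in>Std mu. \<forall>k. 1 \<le> k \<and> k < msize mu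
     \<longrightarrow> qfun q (res q Q mu u k) \<noteq> qfun q (res q Q mu u (Suc k)))"

section \<open>Exponent vectors\<close>

text \<open>An element of \<open>\<int>\<^sub>2\<^sup>n\<close> is a function \<open>nat \<Rightarrow> bit\<close> supported in \<open>{1..n}\<close>; addition is
  pointwise.\<close>

definition Z2 :: "nat set \<Rightarrow> (nat \<Rightarrow> bit) set" where
  "Z2 A = {b. {k. b k = 1} \<subseteq> A}"

definition evec :: "nat \<Rightarrow> nat \<Rightarrow> bit" where
  "evec k = (\<lambda>j. if j = k then 1 else 0)"

text \<open>\<open>wt b {..<i}\<close>, \<open>wt b {..i}\<close>, \<open>wt b {i<..}\<close>, \<open>wt b {i..}\<close> and \<open>wt b UNIV\<close> are
  \<open>|b|\<^bsub><i\<^esub>\<close>, \<open>|b|\<^bsub>\<le>i\<^esub>\<close>, \<open>|b|\<^bsub>>i\<^esub>\<close>, \<open>|b|\<^bsub>\<ge>i\<^esub>\<close> and \<open>|b|\<close>.\<close>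

definition wt :: "(nat \<Rightarrow> bit) \<Rightarrow> nat set \<Rightarrow> nat" where
  "wt b A = card {k \<in> A. b k = 1}"

definition nu :: "(nat \<Rightarrow> bit) \<Rightarrow> nat \<Rightarrow> int" where
  "nu b i = (if b i = 1 then -1 else 1)"

definition delta :: "(nat \<Rightarrow> bit) \<Rightarrow> nat \<Rightarrow> nat" where
  "delta b i = (if b i = 1 then 1 else 0)"

definition swap_exp :: "nat \<Rightarrow> (nat \<Rightarrow> bit) \<Rightarrow> nat \<Rightarrow> bit" where
  "swap_exp i b = b \<circ> transpose i (Suc i)"

section \<open>Vector spaces of functions\<close>

definition fscale :: "'k::field \<Rightarrow> ('a \<Rightarrow> 'k) \<Rightarrow> 'a \<Rightarrow> 'k"  (infixr "\<cdot>" 75) where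
  "c \<cdot> f = (\<lambda>x. c * f x)"

global_interpretation fvec: vector_space "fscale :: 'k::field \<Rightarrow> ('a \<Rightarrow> 'k) \<Rightarrow> 'a \<Rightarrow> 'k"
  by standard (simp_all add: fscale_def fun_eq_iff algebra_simps)

section \<open>The module over the affine Clifford algebra\<close>

text \<open>
  A vector of \<open>M\<close> is its family of coordinates with respect to the basis \<open>C\<^sup>\<beta> v\<close>,
  \<open>\<beta> \<in> \<int>\<^sub>2\<^sup>n\<close>. The operators are the linear extensions of
  \<open>C\<^sub>k C\<^sup>\<beta> v = (-1)\<^bsup>|\<beta>|\<^sub><\<^sub>k\<^esup> C\<^bsup>\<beta>+e\<^sub>k\<^esup> v\<close> and
  \<open>X\<^sub>k C\<^sup>\<beta> v = C\<^sup>\<beta> X\<^sub>k\<^sup>\<plusminus> v\<close> (sign \<open>+\<close> iff \<open>\<beta>\<^sub>k = 0\<close>), which the relations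
  and the action on \<open>v\<close> force.
\<close>

type_synonym 'k mvec = "(nat \<Rightarrow> bit) \<Rightarrow> 'k"

definition M_basis :: "(nat \<Rightarrow> bit) \<Rightarrow> 'k::field mvec" where
  "M_basis b = (\<lambda>c. if c = b then 1 else 0)"

definition M_C :: "nat \<Rightarrow> 'k::field mvec \<Rightarrow> 'k mvec" where
  "M_C k f = (\<lambda>b. (-1) ^ wt b {..<k} * f (b + evec k))"

definition M_X :: "'k::field \<Rightarrow> (nat \<Rightarrow> 'k) \<Rightarrow> ('k \<Rightarrow> 'k) \<Rightarrow> mpart \<Rightarrow> nat \<Rightarrow> 'k mvec \<Rightarrow> 'k mvec" where
  "M_X q Q rt lam k f = (\<lambda>b.
     (if b k = 0 then b_plus q rt (res q Q lam (tab_init lam) k)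
      else b_minus q rt (res q Q lam (tab_init lam) k)) * f b)"

definition M_Xinv :: "'k::field \<Rightarrow> (nat \<Rightarrow> 'k) \<Rightarrow> ('k \<Rightarrow> 'k) \<Rightarrow> mpart \<Rightarrow> nat \<Rightarrow> 'k mvec \<Rightarrow> 'k mvec" where
  "M_Xinv q Q rt lam k f = (\<lambda>b.
     (if b k = 0 then b_minus q rt (res q Q lam (tab_init lam) k)
      else b_plus q rt (res q Q lam (tab_init lam) k)) * f b)"

text \<open>These operators satisfy the relations of \<open>\<A>\<^sub>n\<close>, the coordinate basis consists of the
  vectors \<open>C\<^sup>\<beta> v\<close>, and \<open>v = C\<^sup>0 v\<close> has the prescribed eigenvalues.\<close>

lemma wt_add_evec_le: "i \<le> k \<Longrightarrow> wt (b + evec k) {..<i} = wt b {..<i}"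
  by (auto simp: wt_def evec_def intro!: arg_cong[where f = card])

lemma wt_add_evec_less:
  assumes "k < i"
  shows "(-1 :: 'k::field) ^ wt (b + evec k) {..<i} = - ((-1) ^ wt b {..<i})"
proof -
  let ?A = "{j \<in> {..<i}. j \<noteq> k \<and> b j = 1}"
  have *: "{j \<in> {..<i}. b j = 1} = (if b k = 1 then insert k ?A else ?A)"
          "{j \<in> {..<i}. (b + evec k) j = 1} = (if b k = 1 then ?A else insert k ?A)"
    using assms by (auto simp: evec_def split: if_splits)
  have "finite ?A" "k \<notin> ?A" by auto
  then show ?thesis
    unfolding wt_def * by auto
qed

lemma evec_add_cancel: "b + evec k + evec k = b"
  by (auto simp: fun_eq_iff evec_def)

lemma M_C_square: "M_C k (M_C k f) = f"
  by (auto simp: M_C_def fun_eq_iff wt_add_evec_le evec_add_cancel simp flip: power_add mult_2 mult.assoc)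

lemma M_C_anticommute:
  assumes "i \<noteq> j"
  shows "M_C i (M_C j f) = - M_C j (M_C i f)"
proof -
  have *: "M_C i (M_C j f) = - M_C j (M_C i f)" if "i < j" for i j
    using that
    by (auto simp: M_C_def fun_eq_iff wt_add_evec_le wt_add_evec_less add.assoc add.commute[of "evec i"]
        mult.left_commute)
  show ?thesis
  proof (cases "i < j")
    case False
    then have "M_C j (M_C i f) = - M_C i (M_C j f)" using assms * by auto
    then show ?thesis by simp
  qed (rule *)
qed

lemma b_plus_b_minus:
  fixes q :: "'k::field"
  assumes "(2 :: 'k) \<noteq> 0" "\<And>a. (rt a)\<^sup>2 = a"
  shows "b_plus q rt a * b_minus q rt a = 1"
proof -
  have "b_plus q rt a * b_minus q rt a = (qfun q a / 2)\<^sup>2 - (rt ((qfun q a)\<^sup>2 / 4 - 1))\<^sup>2"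
    by (simp add: b_plus_def b_minus_def power2_eq_square algebra_simps)
  also have "\<dots> = 1"
    using assms by (simp add: power_divide)
  finally show ?thesis .
qed

lemma M_X_M_Xinv:
  fixes q :: "'k::field"
  assumes "(2 :: 'k) \<noteq> 0" "\<And>a. (rt a)\<^sup>2 = a"
  shows "M_X q Q rt lam k (M_Xinv q Q rt lam k f) = f"
    and "M_Xinv q Q rt lam k (M_X q Q rt lam k f) = f"
proof -
  have b: "b_plus q rt a * b_minus q rt a = 1" for a
    by (rule b_plus_b_minus) (use assms in auto)
  show "M_X q Q rt lam k (M_Xinv q Q rt lam k f) = f" "M_Xinv q Q rt lam k (M_X q Q rt lam k f) = f"
    using assms(2)
    by (auto simp: M_X_def M_Xinv_def fun_eq_iff b mult.commute[of "b_minus q rt _" "b_plus q rt _"]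
        simp flip: mult.assoc)
qed

lemma M_X_commute: "M_X q Q rt lam i (M_X q Q rt lam j f) = M_X q Q rt lam j (M_X q Q rt lam i f)"
  by (simp add: M_X_def fun_eq_iff mult.left_commute)

lemma M_X_M_C_same: "M_X q Q rt lam k (M_C k f) = M_C k (M_Xinv q Q rt lam k f)"
  by (auto simp: M_X_def M_Xinv_def M_C_def fun_eq_iff evec_def mult.left_commute)

lemma M_X_M_C_diff: "i \<noteq> j \<Longrightarrow> M_X q Q rt lam i (M_C j f) = M_C j (M_X q Q rt lam i f)"
  by (auto simp: M_X_def M_C_def fun_eq_iff evec_def mult.left_commute)

lemma M_X_init:
  "M_X q Q rt lam k (M_basis 0) = b_plus q rt (res q Q lam (tab_init lam) k) \<cdot> M_basis 0"
  "M_Xinv q Q rt lam k (M_basis 0) = b_minus q rt (res q Q lam (tab_init lam) k) \<cdot> M_basis 0"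
  by (auto simp: M_X_def M_Xinv_def M_basis_def fscale_def fun_eq_iff)

lemma M_basis_eq_C_product:
  assumes "b \<in> Z2 {1..n}"
  shows "foldr (\<lambda>k f. if b k = 1 then M_C k f else f) [1..<Suc n] (M_basis 0) = M_basis b"
proof -
  define r where "r j = (\<lambda>i. if i < j then 0 else b i)" for j
  have *: "foldr (\<lambda>k f. if b k = 1 then M_C k f else f) [j..<Suc n] (M_basis 0) = M_basis (r j)"
    if "j \<le> Suc n" for j
    using that
  proof (induction j rule: inc_induct)
    case base
    have "r (Suc n) = 0"
      using assms by (auto simp: r_def Z2_def fun_eq_iff)
    then show ?case by simp
  next
    case (step j)
    have *: "r j = (if b j = 1 then r (Suc j) + evec j else r (Suc j))"
      by (auto simp: r_def evec_def fun_eq_iff less_Suc_eq)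
    have "wt c {..<j} = 0" if "c + evec j = r (Suc j)" for c
    proof -
      have "c = r (Suc j) + evec j" using that evec_add_cancel[of c j] by metis
      then show ?thesis by (auto simp: wt_def r_def evec_def)
    qed
    moreover have "c + evec j = r (Suc j) \<longleftrightarrow> c = r (Suc j) + evec j" for c
      using evec_add_cancel[of c j] evec_add_cancel[of "r (Suc j)" j] by metis
    ultimately have C: "M_C j (M_basis (r (Suc j))) = M_basis (r (Suc j) + evec j)"
      by (auto simp: M_C_def M_basis_def fun_eq_iff)
    have "[j..<Suc n] = j # [Suc j..<Suc n]"
      using step.hyps by (intro upt_conv_Cons)
    then show ?case
      by (simp only: foldr.simps o_apply step.IH C * split: if_split) simp
  qed
  have "r 1 = b"
    using assms by (auto simp: r_def Z2_def fun_eq_iff)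
  with *[of 1] show ?thesis by simp
qed

text \<open>The vector \<open>\<gamma> v\<close> for the initial tableau: the factors
  \<open>1 + \<surd>(-1) C\<^bsub>x\<^sub>2\<^sub>k\<^sub>-\<^sub>1\<^esub> C\<^bsub>x\<^sub>2\<^sub>k\<^esub>\<close> are applied to \<open>v = C\<^sup>0 v\<close>.\<close>

definition v_init :: "('k::field \<Rightarrow> 'k) \<Rightarrow> mpart \<Rightarrow> 'k mvec" where
  "v_init rt lam =
     inverse (2 ^ (num_diag lam div 2)) \<cdot>
       foldr (\<lambda>k f. f + rt (-1) \<cdot>
                M_C (xp lam (tab_init lam) (2 * k - 1)) (M_C (xp lam (tab_init lam) (2 * k)) f))
         [1..<Suc (num_diag lam div 2)] (M_basis 0)"

text \<open>The submodule generated by \<open>v_init\<close>.\<close>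

definition L_mod :: "'k::field \<Rightarrow> (nat \<Rightarrow> 'k) \<Rightarrow> ('k \<Rightarrow> 'k) \<Rightarrow> mpart \<Rightarrow> 'k mvec set" where
  "L_mod q Q rt lam = \<Inter>{W. fvec.subspace W \<and> v_init rt lam \<in> W \<and>
     (\<forall>k\<in>{1..msize lam}. \<forall>z\<in>W.
        M_X q Q rt lam k z \<in> W \<and> M_Xinv q Q rt lam k z \<in> W \<and> M_C k z \<in> W)}"

section \<open>The module \<open>\<D>(\<lambda>)\<close>\<close>

text \<open>
  Since \<open>L\<^sup>d\<close> is a copy of \<open>L\<close>, a vector of the direct sum is a family \<open>F\<close> whose
  component at \<open>t\<close>, the function \<open>\<lambda>b. F (t, b)\<close>, lies in \<open>L\<close> if \<open>t\<close> is standard and is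
  \<open>0\<close> otherwise; \<open>emb t z\<close> is \<open>z\<^sup>d\<close> for \<open>d = d(t, t\<^sup>\<lambda>)\<close>. The twist
  \<open>C\<^bsub>d(k)\<^esub> z\<^sup>d = (C\<^sub>k z)\<^sup>d\<close> appears as \<open>inv d\<close> in the operators.
  \<open>D_X\<close>, \<open>D_Xinv\<close>, \<open>D_C\<close> and \<open>D_T\<close> below are the actions of the generators of
  \<open>\<H>\<^sub>c\<^sup>f(n)\<close>.
\<close>

type_synonym 'k dvec = "tableau \<times> (nat \<Rightarrow> bit) \<Rightarrow> 'k"

definition part :: "tableau \<Rightarrow> 'k dvec \<Rightarrow> 'k mvec" where
  "part t F = (\<lambda>b. F (t, b))"

definition emb :: "tableau \<Rightarrow> 'k::field mvec \<Rightarrow> 'k dvec" where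
  "emb t z = (\<lambda>(s, b). if s = t then z b else 0)"

definition D_mod :: "'k::field \<Rightarrow> (nat \<Rightarrow> 'k) \<Rightarrow> ('k \<Rightarrow> 'k) \<Rightarrow> mpart \<Rightarrow> 'k dvec set" where
  "D_mod q Q rt lam = {F. \<forall>t. if t \<in> Std lam then part t F \<in> L_mod q Q rt lam else part t F = 0}"

definition D_C :: "mpart \<Rightarrow> nat \<Rightarrow> 'k::field dvec \<Rightarrow> 'k dvec" where
  "D_C lam k F = (\<lambda>(t, b). M_C (inv (dperm lam t (tab_init lam)) k) (part t F) b)"

definition D_X :: "'k::field \<Rightarrow> (nat \<Rightarrow> 'k) \<Rightarrow> ('k \<Rightarrow> 'k) \<Rightarrow> mpart \<Rightarrow> nat \<Rightarrow> 'k dvec \<Rightarrow> 'k dvec" where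
  "D_X q Q rt lam k F =
     (\<lambda>(t, b). M_X q Q rt lam (inv (dperm lam t (tab_init lam)) k) (part t F) b)"

definition D_Xinv :: "'k::field \<Rightarrow> (nat \<Rightarrow> 'k) \<Rightarrow> ('k \<Rightarrow> 'k) \<Rightarrow> mpart \<Rightarrow> nat \<Rightarrow> 'k dvec \<Rightarrow> 'k dvec" where
  "D_Xinv q Q rt lam k F =
     (\<lambda>(t, b). M_Xinv q Q rt lam (inv (dperm lam t (tab_init lam)) k) (part t F) b)"

definition bt :: "'k::field \<Rightarrow> (nat \<Rightarrow> 'k) \<Rightarrow> ('k \<Rightarrow> 'k) \<Rightarrow> mpart \<Rightarrow> tableau \<Rightarrow> nat \<Rightarrow> 'k" where
  "bt q Q rt lam t i = b_minus q rt (res q Q lam t i)"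

definition ct :: "'k::field \<Rightarrow> (nat \<Rightarrow> 'k) \<Rightarrow> ('k \<Rightarrow> 'k) \<Rightarrow> mpart \<Rightarrow> tableau \<Rightarrow> nat \<Rightarrow> 'k" where
  "ct q Q rt lam t i =
     (let a = bt q Q rt lam t i; b = bt q Q rt lam t (Suc i) in
      1 - (eps q)\<^sup>2 * ((inverse a * b) / (inverse a * b - 1)\<^sup>2 + (a * b) / (a * b - 1)\<^sup>2))"

definition std_delta :: "mpart \<Rightarrow> tableau \<Rightarrow> 'k::field" where
  "std_delta lam t = (if t \<in> Std lam then 1 else 0)"

text \<open>
  \<open>D_T_on \<dots> i t z\<close> is \<open>T\<^sub>i z\<^sup>d\<close>. The fractions in the defining formula are inverses of
  operators on the summand \<open>L\<^sup>d\<close>; they are applied after \<open>C\<^sub>i C\<^bsub>i+1\<^esub>\<close>.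
\<close>

definition D_T_on :: "'k::field \<Rightarrow> (nat \<Rightarrow> 'k) \<Rightarrow> ('k \<Rightarrow> 'k) \<Rightarrow> mpart \<Rightarrow> nat \<Rightarrow> tableau \<Rightarrow> 'k mvec \<Rightarrow> 'k dvec" where
  "D_T_on q Q rt lam i t z =
     (let X = D_X q Q rt lam; Xinv = D_Xinv q Q rt lam; C = D_C lam; Ld = emb t ` L_mod q Q rt lam in
      - (eps q \<cdot> inv_into Ld (\<lambda>w. X i (Xinv (Suc i) w) - w) (emb t z))
      + eps q \<cdot> inv_into Ld (\<lambda>w. X i (X (Suc i) w) - w) (C i (C (Suc i) (emb t z)))
      + (std_delta lam (swap_tab i t) * rt (ct q Q rt lam t i)) \<cdot> emb (swap_tab i t) z)"

definition D_T :: "'k::field \<Rightarrow> (nat \<Rightarrow> 'k) \<Rightarrow> ('k \<Rightarrow> 'k) \<Rightarrow> mpart \<Rightarrow> nat \<Rightarrow> 'k dvec \<Rightarrow> 'k dvec" where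
  "D_T q Q rt lam i F = (\<Sum>t\<in>Std lam. D_T_on q Q rt lam i t (part t F))"

text \<open>\<open>C\<^sup>\<beta> = C\<^sub>1\<^bsup>\<beta>\<^sub>1\<^esup> \<cdots> C\<^sub>n\<^bsup>\<beta>\<^sub>n\<^esup>\<close> as an operator on \<open>\<D>(\<lambda>)\<close>.\<close>

definition D_Cpow :: "mpart \<Rightarrow> (nat \<Rightarrow> bit) \<Rightarrow> 'k::field dvec \<Rightarrow> 'k dvec" where
  "D_Cpow lam b F =
     foldr (\<lambda>k G. if b k = 1 then D_C lam k G else G) [1..<Suc (msize lam)] F"

definition vt :: "('k::field \<Rightarrow> 'k) \<Rightarrow> mpart \<Rightarrow> tableau \<Rightarrow> 'k dvec" where
  "vt rt lam t = emb t (v_init rt lam)"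

definition CCv :: "('k::field \<Rightarrow> 'k) \<Rightarrow> mpart \<Rightarrow> tableau \<Rightarrow> (nat \<Rightarrow> bit) \<Rightarrow> (nat \<Rightarrow> bit) \<Rightarrow> 'k dvec" where
  "CCv rt lam t \<beta> \<alpha> = D_Cpow lam \<beta> (D_Cpow lam \<alpha> (vt rt lam t))"

text \<open>
  Expressing \<open>C\<^sub>i C\<^bsub>i+1\<^esub> C\<^sup>\<beta> C\<^sup>\<alpha> v\<^sub>t\<close> in these vectors when \<open>i\<close> is a diagonal entry of \<open>t\<close>
  and \<open>i + 1\<close> is not: \<open>C\<^sub>i\<close> has to pass \<open>C\<^bsup>\<beta>+e\<^sub>i\<^sub>+\<^sub>1\<^esup>\<close>, which contributes
  \<open>(-1)\<^bsup>|\<beta>|+1\<^esup>\<close>; as \<open>\<beta>\<^sub>i = 0\<close>, the sign coming from \<open>\<beta>\<close> is \<open>(-1)\<^bsup>|\<beta>|\<^sub>>\<^sub>i+1\<^esup>\<close>. For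
  example \<open>C\<^sub>1 C\<^sub>2 v\<^sub>t = - C\<^sub>2 C\<^sub>1 v\<^sub>t\<close>.
\<close>

definition basis_index ::
    "mpart \<Rightarrow> (tableau \<times> (nat \<Rightarrow> bit) \<times> (nat \<Rightarrow> bit)) set" where
  "basis_index lam = (SIGMA t : Std lam. Z2 ({1..msize lam} - Dtab lam t) \<times> Z2 (ODtab lam t))"

end

theory Submission
  imports Defs
begin

text \<open>
  For a standard tableau \<open>t\<close> with \<open>d = d(t, t\<^sup>\<lambda>)\<close>, the operator \<open>C\<^sub>k\<close> acts on the summand
  \<open>L\<^sup>d\<close> as \<open>C\<close> with index \<open>d\<^sup>-\<^sup>1(k)\<close> on \<open>L \<subseteq> M\<close>, so everything reduces to words in the
  operators \<open>C\<close> with relabelled indices applied to \<open>\<gamma> v\<close> inside \<open>M\<close>. The factor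
  \<open>1 + \<surd>(-1) C\<^sub>a C\<^sub>b\<close> of \<open>\<gamma>\<close> gives \<open>C\<^sub>b \<gamma> v = - \<surd>(-1) C\<^sub>a \<gamma> v\<close>, which together with sign
  bookkeeping yields the action of the \<open>C\<^sub>i\<close> and hence spanning. For independence, expand
  \<open>\<gamma>\<close>: the only term of \<open>\<gamma> v\<close> avoiding all \<open>C\<close> indexed by the even-numbered diagonal entries
  is a multiple of \<open>v\<close>, so the coordinate at \<open>C\<^bsup>\<beta>+\<alpha>\<^esup> v\<close> is nonzero on
  \<open>C\<^sup>\<beta> C\<^sup>\<alpha> \<gamma> v\<close> and zero on the other vectors of the family.
  The denominators in \<open>T\<^sub>i\<close> are invertible since \<open>b\<^sub>i b\<^sub>i\<^sub>+\<^sub>1\<^sup>\<plusminus>\<^sup>1 \<noteq> 1\<close> follows from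
  \<open>q(res(i)) \<noteq> q(res(i + 1))\<close>; as separateness is assumed for size \<open>n + 1\<close>, the tableau is
  first enlarged by a box at the end of a first row.
\<close>

section \<open>Scalars, signs and scaling of functions\<close>

lemma two_neq_zero:
  assumes "CHAR('k::field) \<noteq> 2"
  shows "(2 :: 'k) \<noteq> 0"
proof
  assume "(2 :: 'k) = 0"
  then have "of_nat 2 = (0 :: 'k)" by simp
  then have "CHAR('k) dvd 2" by (simp only: of_nat_eq_0_iff_char_dvd)
  then have "CHAR('k) = 1 \<or> CHAR('k) = 2"
    by (metis prime_nat_iff two_is_prime_nat)
  then show False
    using assms CHAR_not_1 by auto
qed

text \<open>Turns later comparisons of signs into parity questions about exponents.\<close>

lemma neg_one_power_cong:
  "even (a + b) \<Longrightarrow> (- 1 :: 'k::field) ^ a = (- 1) ^ b"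
  by (cases "even a"; cases "even b") auto

lemma fscale_simps [simp]:
  "(0 :: 'k::field) \<cdot> f = 0" "(1 :: 'k) \<cdot> f = f" "(c :: 'k) \<cdot> (0 :: 'a \<Rightarrow> 'k) = 0"
  "c \<cdot> d \<cdot> f = (c * d) \<cdot> (f :: 'a \<Rightarrow> 'k)"
  by (auto simp: fscale_def fun_eq_iff)

section \<open>Exponent vectors\<close>

lemma wt_evec_outside: "i \<notin> A \<Longrightarrow> wt (b + evec i) A = wt b A"
  by (auto simp: wt_def evec_def intro!: arg_cong[where f = card])

text \<open>Finite support matters because \<open>card\<close> of an infinite set is 0, so
  additivity could fail without it.\<close>

lemma wt_Un_disjoint:
  assumes "finite {k. b k = 1}" "A \<inter> B = {}"
  shows "wt b (A \<union> B) = wt b A + wt b B"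
proof -
  have *: "{k \<in> A \<union> B. b k = 1} = {k \<in> A. b k = 1} \<union> {k \<in> B. b k = 1}" by auto
  have "finite {k \<in> A. b k = 1}" "finite {k \<in> B. b k = 1}"
    by (rule finite_subset[OF _ assms(1)]; auto)+
  then show ?thesis
    unfolding wt_def * using assms(2) by (intro card_Un_disjoint) auto
qed

lemma wt_supp_cong:
  assumes "\<And>k. b k = 1 \<Longrightarrow> k \<in> A \<longleftrightarrow> k \<in> B"
  shows "wt b A = wt b B"
  unfolding wt_def by (rule arg_cong[where f = card]) (use assms in auto)

lemma finite_supp_Z2: "b \<in> Z2 A \<Longrightarrow> finite A \<Longrightarrow> finite {k. b k = 1}"
  by (auto simp: Z2_def intro: finite_subset)

lemma Z2_eq_0: "b \<in> Z2 A \<Longrightarrow> k \<notin> A \<Longrightarrow> b k = 0"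
  by (auto simp: Z2_def)

lemma Z2_mono: "A \<subseteq> B \<Longrightarrow> b \<in> Z2 A \<Longrightarrow> b \<in> Z2 B"
  by (auto simp: Z2_def)

lemma Z2_0: "0 \<in> Z2 A"
  by (auto simp: Z2_def)

lemma Z2_add: "a \<in> Z2 A \<Longrightarrow> b \<in> Z2 A \<Longrightarrow> a + b \<in> Z2 A"
  by (auto simp: Z2_def)

lemma evec_Z2: "k \<in> A \<Longrightarrow> evec k \<in> Z2 A"
  by (auto simp: Z2_def evec_def split: if_splits)

lemma exp_add_self: "b + b = (0 :: nat \<Rightarrow> bit)"
  by (auto simp: fun_eq_iff)

section \<open>Clifford words\<close>

lemma M_C_add: "M_C k (f + g) = M_C k f + M_C k g"
  by (auto simp: M_C_def fun_eq_iff algebra_simps)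

lemma M_C_scale: "M_C k (c \<cdot> f) = c \<cdot> M_C k f"
  by (auto simp: M_C_def fscale_def fun_eq_iff)

lemma M_C_zero: "M_C k 0 = 0"
  by (auto simp: M_C_def fun_eq_iff)

text \<open>The map \<sigma> relabels the letters, while their order stays that of
  \<open>ks\<close>. With \<sigma> the inverse of d(t, t^\<lambda>) and the full list of indices
  this is C^b on the summand L^d, transported back to M.\<close>

definition word :: "(nat \<Rightarrow> nat) \<Rightarrow> (nat \<Rightarrow> bit) \<Rightarrow> nat list \<Rightarrow> 'k::field mvec \<Rightarrow> 'k mvec" where
  "word \<sigma> b ks f = foldr (\<lambda>k g. if b k = 1 then M_C (\<sigma> k) g else g) ks f"

lemma word_Nil [simp]: "word \<sigma> b [] f = f"
  and word_Cons: "word \<sigma> b (k # ks) f =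
    (if b k = 1 then M_C (\<sigma> k) (word \<sigma> b ks f) else word \<sigma> b ks f)"
  and word_append: "word \<sigma> b (ks @ ls) f = word \<sigma> b ks (word \<sigma> b ls f)"
  by (simp_all add: word_def)

lemma word_cong:
  assumes "\<And>k. k \<in> set ks \<Longrightarrow> b k = b' k" "\<And>k. k \<in> set ks \<Longrightarrow> \<sigma> k = \<sigma>' k"
  shows "word \<sigma> b ks f = word \<sigma>' b' ks f"
  using assms by (induction ks) (auto simp: word_Cons)

lemma word_scale: "word \<sigma> b ks (c \<cdot> f) = c \<cdot> word \<sigma> b ks f"
  by (induction ks) (simp_all add: word_Cons M_C_scale)

lemma word_zero: "word \<sigma> 0 ks f = f"
  by (induction ks) (auto simp: word_Cons)

lemma fun_uminus_scale: "- (c \<cdot> f) = (- c :: 'k::field) \<cdot> f"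
  by (auto simp: fscale_def fun_eq_iff)

text \<open>Injectivity of \<sigma> gives every letter present in the word a label other than
  \<open>\<sigma> i\<close>, so moving \<open>M_C (\<sigma> i)\<close> through the word costs one
  sign per letter.\<close>

lemma M_C_word:
  assumes "inj \<sigma>" "distinct ks" "\<And>k. k \<in> set ks \<Longrightarrow> b k = 1 \<Longrightarrow> k \<noteq> i"
  shows "M_C (\<sigma> i) (word \<sigma> b ks f) = (- 1) ^ wt b (set ks) \<cdot> word \<sigma> b ks (M_C (\<sigma> i) f)"
  using assms(2,3)
proof (induction ks)
  case Nil
  then show ?case by (simp add: wt_def)
next
  case (Cons k ks)
  have IH: "M_C (\<sigma> i) (word \<sigma> b ks f) = (- 1) ^ wt b (set ks) \<cdot> word \<sigma> b ks (M_C (\<sigma> i) f)"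
    using Cons by auto
  have wt: "wt b (set (k # ks)) = (if b k = 1 then Suc (wt b (set ks)) else wt b (set ks))"
  proof -
    have "{j \<in> set (k # ks). b j = 1} =
        (if b k = 1 then insert k {j \<in> set ks. b j = 1} else {j \<in> set ks. b j = 1})" by auto
    moreover have "k \<notin> {j \<in> set ks. b j = 1}" using Cons.prems by auto
    ultimately show ?thesis by (auto simp: wt_def)
  qed
  show ?case
  proof (cases "b k = 1")
    case True
    then have "\<sigma> i \<noteq> \<sigma> k" using Cons.prems(2)[of k] True inj_eq[OF assms(1)] by auto
    have "M_C (\<sigma> i) (word \<sigma> b (k # ks) f) = - M_C (\<sigma> k) (M_C (\<sigma> i) (word \<sigma> b ks f))"
      unfolding word_Cons by (simp only: True simp_thms if_True M_C_anticommute[OF \<open>\<sigma> i \<noteq> \<sigma> k\<close>])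
    also have "\<dots> = (- ((- 1) ^ wt b (set ks))) \<cdot> M_C (\<sigma> k) (word \<sigma> b ks (M_C (\<sigma> i) f))"
      by (simp only: IH M_C_scale fun_uminus_scale)
    also have "\<dots> = (- 1) ^ wt b (set (k # ks)) \<cdot> word \<sigma> b (k # ks) (M_C (\<sigma> i) f)"
      unfolding wt word_Cons using True by (simp only: if_True power_Suc) simp
    finally show ?thesis .
  next
    case False
    then show ?thesis by (simp only: word_Cons wt IH if_False)
  qed
qed

lemma word_M_C:
  assumes "inj \<sigma>" "distinct ks" "\<And>k. k \<in> set ks \<Longrightarrow> b k = 1 \<Longrightarrow> k \<noteq> i"
  shows "word \<sigma> b ks (M_C (\<sigma> i) f) = (- 1) ^ wt b (set ks) \<cdot> M_C (\<sigma> i) (word \<sigma> b ks f)"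
  by (simp add: M_C_word[OF assms])

lemma upt_split:
  assumes "i \<in> {1..n}"
  shows "[1..<Suc n] = [1..<i] @ i # [Suc i..<Suc n]"
  using assms upt_add_eq_append[of 1 i "Suc n - i"] by (simp add: upt_conv_Cons del: upt_Suc)

text \<open>From the left the new letter passes exactly the letters at positions below i. At
  position i it creates a letter or, as C squares to 1, cancels the one already there; both are
  addition of \<open>evec i\<close> modulo 2.\<close>

lemma M_C_word_insert:
  assumes "inj \<sigma>" "b \<in> Z2 {1..n}" "i \<in> {1..n}"
  shows "M_C (\<sigma> i) (word \<sigma> b [1..<Suc n] f) =
    (- 1) ^ wt b {..<i} \<cdot> word \<sigma> (b + evec i) [1..<Suc n] f"
proof -
  have e: "word \<sigma> (b + evec i) [1..<i] g = word \<sigma> b [1..<i] g"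
    "word \<sigma> (b + evec i) [Suc i..<Suc n] g = word \<sigma> b [Suc i..<Suc n] g" for g
    by (rule word_cong; auto simp: evec_def)+
  have m: "M_C (\<sigma> i) (word \<sigma> b [i] g) = word \<sigma> (b + evec i) [i] g" for g
    by (auto simp: word_Cons evec_def M_C_square)
  have w: "wt b (set [1..<i]) = wt b {..<i}"
    using assms(2) by (intro wt_supp_cong) (auto simp: Z2_def)
  have s: "word \<sigma> b [1..<Suc n] f = word \<sigma> b [1..<i] (word \<sigma> b [i] (word \<sigma> b [Suc i..<Suc n] f))" for b
    unfolding upt_split[OF assms(3)] by (simp add: word_append word_Cons)
  have p: "M_C (\<sigma> i) (word \<sigma> b [1..<i] g) = (- 1) ^ wt b {..<i} \<cdot> word \<sigma> b [1..<i] (M_C (\<sigma> i) g)" for g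
    unfolding w[symmetric] using assms(1) by (intro M_C_word) auto
  show ?thesis
    by (simp only: s p m e)
qed

text \<open>Mirror image of the insertion from the left: now the letters beyond i are
  passed.\<close>

lemma word_M_C_insert:
  assumes "inj \<sigma>" "b \<in> Z2 {1..n}" "i \<in> {1..n}"
  shows "word \<sigma> b [1..<Suc n] (M_C (\<sigma> i) f) =
    (- 1) ^ wt b {i<..} \<cdot> word \<sigma> (b + evec i) [1..<Suc n] f"
proof -
  have e: "word \<sigma> (b + evec i) [1..<i] g = word \<sigma> b [1..<i] g"
    "word \<sigma> (b + evec i) [Suc i..<Suc n] g = word \<sigma> b [Suc i..<Suc n] g" for g
    by (rule word_cong; auto simp: evec_def)+
  have m: "word \<sigma> b [i] (M_C (\<sigma> i) g) = word \<sigma> (b + evec i) [i] g" for g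
    by (auto simp: word_Cons evec_def M_C_square)
  have w: "wt b (set [Suc i..<Suc n]) = wt b {i<..}"
    using assms(2) by (intro wt_supp_cong) (auto simp: Z2_def)
  have s: "word \<sigma> b [1..<Suc n] f = word \<sigma> b [1..<i] (word \<sigma> b [i] (word \<sigma> b [Suc i..<Suc n] f))" for b f
    unfolding upt_split[OF assms(3)] by (simp add: word_append word_Cons)
  have "word \<sigma> b [Suc i..<Suc n] (M_C (\<sigma> i) f) =
      (- 1) ^ wt b {i<..} \<cdot> M_C (\<sigma> i) (word \<sigma> b [Suc i..<Suc n] f)"
    unfolding w[symmetric] using assms(1) by (intro word_M_C) auto
  then show ?thesis
    by (simp only: s word_scale m e)
qed

text \<open>Applies when the letter i is absent, as for a diagonal entry and C^\<beta>: the new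
  letter then anticommutes with the whole word and reaches what stands behind it.\<close>

lemma M_C_word_pass:
  assumes "inj \<sigma>" "b \<in> Z2 {1..n}" "b i = 0"
  shows "M_C (\<sigma> i) (word \<sigma> b [1..<Suc n] f) =
    (- 1) ^ wt b UNIV \<cdot> word \<sigma> b [1..<Suc n] (M_C (\<sigma> i) f)"
proof -
  have w: "wt b (set [1..<Suc n]) = wt b UNIV"
    using assms(2) by (intro wt_supp_cong) (auto simp: Z2_def)
  show ?thesis
    unfolding w[symmetric] using assms by (intro M_C_word) auto
qed

lemma word_cong_swap:
  assumes "i \<notin> set ks" "Suc i \<notin> set ks"
  shows "word (\<sigma> \<circ> transpose i (Suc i)) (swap_exp i b) ks f = word \<sigma> b ks f"
proof -
  have *: "transpose i (Suc i) k = k" if "k \<in> set ks" for k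
    using that assms by (intro transpose_apply_other) auto
  show ?thesis
    by (intro word_cong) (simp_all only: swap_exp_def o_apply *)
qed

text \<open>Transposing both labels and exponents leaves the same Clifford letters in the word, but
  those at positions i and i + 1 in opposite order. A sign appears only if both are present; it
  becomes the sign in the last term of T_i.\<close>

lemma word_swap:
  assumes "inj \<sigma>" "1 \<le> i" "Suc i \<le> n"
  shows "word (\<sigma> \<circ> transpose i (Suc i)) (swap_exp i b) [1..<Suc n] f =
    (- 1) ^ (delta b i * delta b (Suc i)) \<cdot> word \<sigma> b [1..<Suc n] f"
proof -
  let ?\<sigma> = "\<sigma> \<circ> transpose i (Suc i)" and ?b = "swap_exp i b"
  have e: "word ?\<sigma> ?b [1..<i] g = word \<sigma> b [1..<i] g"
    "word ?\<sigma> ?b [Suc (Suc i)..<Suc n] g = word \<sigma> b [Suc (Suc i)..<Suc n] g" for g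
    by (intro word_cong_swap; simp only: set_upt atLeastLessThan_iff; linarith)+
  have ne: "\<sigma> (Suc i) \<noteq> \<sigma> i"
    using inj_eq[OF assms(1)] by simp
  have m: "word ?\<sigma> ?b [i, Suc i] g = (- 1) ^ (delta b i * delta b (Suc i)) \<cdot> word \<sigma> b [i, Suc i] g" for g
  proof -
    have [simp]: "?\<sigma> i = \<sigma> (Suc i)" "?\<sigma> (Suc i) = \<sigma> i" "?b i = b (Suc i)" "?b (Suc i) = b i"
      by (simp_all add: swap_exp_def)
    have "M_C (\<sigma> (Suc i)) (M_C (\<sigma> i) g) = (- 1) \<cdot> M_C (\<sigma> i) (M_C (\<sigma> (Suc i)) g)"
      unfolding M_C_anticommute[OF ne] by (simp only: fscale_def fun_eq_iff uminus_apply mult_minus1 simp_thms)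
    then show ?thesis
      by (cases "b i = 1"; cases "b (Suc i) = 1") (simp_all add: word_Cons delta_def)
  qed
  have "[1..<Suc n] = [1..<i] @ [i, Suc i] @ [Suc (Suc i)..<Suc n]"
  proof -
    have "[Suc i..<Suc n] = Suc i # [Suc (Suc i)..<Suc n]"
      using assms by (intro upt_conv_Cons) auto
    then show ?thesis
      using upt_split[of i n] assms by (simp del: upt_Suc)
  qed
  then show ?thesis
    by (simp only: word_append e m word_scale)
qed

text \<open>In coordinates each C is a signed translation of the exponent vector, so a word is one
  too. The sign may depend on the coordinate but not on the vector acted on; for the support
  arguments it only matters that it is nonzero.\<close>

lemma word_coord_list:
  fixes b :: "nat \<Rightarrow> bit"
  assumes "inj \<sigma>" "distinct ks"
  shows "\<exists>s :: (nat \<Rightarrow> bit) \<Rightarrow> 'a::field. (\<forall>c. s c = 1 \<or> s c = - 1) \<and>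
    (\<forall>f c. word \<sigma> b ks f c = s c * f (c + (\<lambda>j. of_bool (\<exists>k\<in>set ks. b k = 1 \<and> j = \<sigma> k))))"
  using assms(2)
proof (induction ks)
  case Nil
  have "c + (\<lambda>j. of_bool False) = c" for c :: "nat \<Rightarrow> bit" by (auto simp: fun_eq_iff)
  then show ?case by (intro exI[of _ "\<lambda>_. 1"]) auto
next
  case (Cons k ks)
  let ?B = "\<lambda>ks j. of_bool (\<exists>k\<in>set ks. b k = 1 \<and> j = \<sigma> k) :: bit"
  obtain s :: "(nat \<Rightarrow> bit) \<Rightarrow> 'a" where s: "\<And>c. s c = 1 \<or> s c = - 1" "\<And>f c. word \<sigma> b ks f c = s c * f (c + ?B ks)"
    using Cons.IH Cons.prems unfolding distinct.simps by blast
  show ?case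
  proof (cases "b k = 1")
    case True
    \<comment> \<open>As the list is distinct and \<sigma> injective, the label of k does not recur
      in \<open>ks\<close>, so nothing cancels modulo 2.\<close>
    have "?B (k # ks) = evec (\<sigma> k) + ?B ks"
    proof
      fix j
      show "?B (k # ks) j = (evec (\<sigma> k) + ?B ks) j"
      proof (cases "j = \<sigma> k")
        case j: True
        have "\<not> (\<exists>l\<in>set ks. b l = 1 \<and> j = \<sigma> l)"
          using Cons.prems j inj_eq[OF assms(1)] by auto
        then show ?thesis using j True by (simp add: evec_def)
      qed (simp add: evec_def)
    qed
    then have "word \<sigma> b (k # ks) f c = ((- 1) ^ wt c {..<\<sigma> k} * s (c + evec (\<sigma> k))) * f (c + ?B (k # ks))" for f c
      using True by (simp add: word_Cons M_C_def s(2) add.assoc)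
    moreover have "(- 1) ^ wt c {..<\<sigma> k} * s (c + evec (\<sigma> k)) = 1 \<or>
      (- 1) ^ wt c {..<\<sigma> k} * s (c + evec (\<sigma> k)) = - 1" for c
      using s(1)[of "c + evec (\<sigma> k)"] by (cases "even (wt c {..<\<sigma> k})") auto
    ultimately show ?thesis
      by (intro exI[of _ "\<lambda>c. (- 1) ^ wt c {..<\<sigma> k} * s (c + evec (\<sigma> k))"]) blast
  next
    case False
    then have "?B (k # ks) = ?B ks" by auto
    then have "\<forall>f c. word \<sigma> b (k # ks) f c = s c * f (c + ?B (k # ks))"
      using False by (simp only: word_Cons s(2) if_False) blast
    with s(1) show ?thesis by blast
  qed
qed

lemma word_coord:
  assumes "bij \<sigma>" "b \<in> Z2 {1..n}"
  obtains s :: "(nat \<Rightarrow> bit) \<Rightarrow> 'k::field" where "\<And>c. s c = 1 \<or> s c = - 1"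
    "\<And>f c. word \<sigma> b [1..<Suc n] f c = s c * f (c + (b \<circ> inv \<sigma>))"
proof -
  have eq: "(\<lambda>j. of_bool (\<exists>k\<in>set [1..<Suc n]. b k = 1 \<and> j = \<sigma> k)) = b \<circ> inv \<sigma>"
  proof
    fix j
    have "(\<exists>k\<in>set [1..<Suc n]. b k = 1 \<and> j = \<sigma> k) \<longleftrightarrow> b (inv \<sigma> j) = 1"
      using assms surj_f_inv_f[OF bij_is_surj[OF assms(1)], of j] inv_f_f[OF bij_is_inj[OF assms(1)]]
      by (auto simp: Z2_def simp del: upt_Suc intro!: bexI[of _ "inv \<sigma> j"])
    then show "of_bool (\<exists>k\<in>set [1..<Suc n]. b k = 1 \<and> j = \<sigma> k) = (b \<circ> inv \<sigma>) j"
      by (cases "b (inv \<sigma> j)") auto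
  qed
  from word_coord_list[OF bij_is_inj[OF assms(1)] distinct_upt[of 1 "Suc n"], where b = b]
  obtain s :: "(nat \<Rightarrow> bit) \<Rightarrow> 'k" where s: "\<forall>c. s c = 1 \<or> s c = - 1"
    "\<forall>f c. word \<sigma> b [1..<Suc n] f c = s c * f (c + (b \<circ> inv \<sigma>))"
    unfolding eq by (elim exE conjE)
  show thesis by (rule that[of s]) (use s in blast)+
qed

section \<open>The vector \<open>\<gamma> v\<close>\<close>

text \<open>Here y enumerates N disjoint pairs, the k-th one sitting at positions 2k - 1 and 2k. The
  index is written with \<open>Suc 0\<close> to match the form that simplification produces.\<close>

lemma inj_on_pairs:
  assumes "inj_on y {1..2 * N}" "k \<in> {1..N}" "l \<in> {1..N}"
  shows "y (2 * k) = y (2 * l) \<longleftrightarrow> k = l"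
    and "y (2 * k - Suc 0) = y (2 * l - Suc 0) \<longleftrightarrow> k = l"
    and "y (2 * k) \<noteq> y (2 * l - Suc 0)"
    and "y (2 * k - Suc 0) \<noteq> y (2 * l)"
proof -
  have y: "y i = y j \<longleftrightarrow> i = j" if "i \<in> {1..2 * N}" "j \<in> {1..2 * N}" for i j
    using assms(1) that by (auto dest: inj_onD)
  have m: "2 * i \<in> {1..2 * N}" "2 * i - Suc 0 \<in> {1..2 * N}" if "i \<in> {1..N}" for i
    using that by auto
  have "2 * k \<noteq> 2 * l - Suc 0" "2 * l \<noteq> 2 * k - Suc 0"
      "2 * k - Suc 0 = 2 * l - Suc 0 \<longleftrightarrow> k = l"
    using assms(2,3) by (simp_all, presburger+)
  then show "y (2 * k) = y (2 * l) \<longleftrightarrow> k = l"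
    "y (2 * k - Suc 0) = y (2 * l - Suc 0) \<longleftrightarrow> k = l"
    "y (2 * k) \<noteq> y (2 * l - Suc 0)" "y (2 * k - Suc 0) \<noteq> y (2 * l)"
    using assms(2,3) by (auto simp only: y m)
qed

text \<open>This is \<gamma> v without its power of 2, for an arbitrary list of pairs, so that
  induction can split off one factor at a time.\<close>

definition gam :: "'k::field \<Rightarrow> (nat \<Rightarrow> nat) \<Rightarrow> nat list \<Rightarrow> 'k mvec" where
  "gam I y ks = foldr (\<lambda>k f. f + I \<cdot> M_C (y (2 * k - 1)) (M_C (y (2 * k)) f)) ks (M_basis 0)"

lemma gam_Cons: "gam I y (k # ks) =
    gam I y ks + I \<cdot> M_C (y (2 * k - 1)) (M_C (y (2 * k)) (gam I y ks))"
  by (simp add: gam_def)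

text \<open>Each factor 1 + I C C' contributes either nothing or both members of its pair, so the
  exponents in the expansion are unions of whole pairs.\<close>

lemma gam_support:
  assumes "inj_on y {1..2 * N}" "set ks \<subseteq> {1..N}" "gam I y ks c \<noteq> 0"
  shows "(\<forall>k\<in>{1..N}. c (y (2 * k)) = c (y (2 * k - 1))) \<and>
    (\<forall>j. c j = 1 \<longrightarrow> (\<exists>k\<in>set ks. j = y (2 * k) \<or> j = y (2 * k - 1)))"
  using assms(2,3)
proof (induction ks arbitrary: c)
  case Nil
  then show ?case by (auto simp: gam_def M_basis_def split: if_splits)
next
  case (Cons k ks)
  let ?e = "evec (y (2 * k - 1)) + evec (y (2 * k))"
  have "gam I y (k # ks) c = 0" if "gam I y ks c = 0" "gam I y ks (c + ?e) = 0"
    using that by (simp add: gam_Cons M_C_def fscale_def add.assoc)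
  then consider "gam I y ks c \<noteq> 0" | "gam I y ks (c + ?e) \<noteq> 0"
    using Cons.prems by auto
  then show ?case
  proof cases
    case 1
    have "set ks \<subseteq> {1..N}" using Cons.prems by auto
    from Cons.IH[OF this 1] show ?thesis by (meson list.set_intros(2))
  next
    case 2
    have IH: "\<forall>l\<in>{1..N}. (c + ?e) (y (2 * l)) = (c + ?e) (y (2 * l - 1))"
      "\<forall>j. (c + ?e) j = 1 \<longrightarrow> (\<exists>k\<in>set ks. j = y (2 * k) \<or> j = y (2 * k - 1))"
      using Cons.IH[OF _ 2] Cons.prems(1) by (metis insert_subset list.simps(15))+
    \<comment> \<open>On the pair l the vector \<open>?e\<close> is 1 at both members if l = k and 0
      at both otherwise.\<close>
    have eq: "?e (y (2 * l)) = ?e (y (2 * l - 1))" if "l \<in> {1..N}" for l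
    proof -
      have k: "k \<in> {1..N}" using Cons.prems by auto
      show ?thesis
        using inj_on_pairs[OF assms(1) that k] inj_on_pairs[OF assms(1) that that]
          inj_on_pairs[OF assms(1) k k]
        by (simp add: evec_def)
    qed
    have "c (y (2 * l)) = c (y (2 * l - 1))" if "l \<in> {1..N}" for l
    proof -
      have "c (y (2 * l)) + ?e (y (2 * l)) = c (y (2 * l - 1)) + ?e (y (2 * l - 1))"
        using bspec[OF IH(1) that] by simp
      then show ?thesis unfolding eq[OF that] by (rule add_right_imp_eq)
    qed
    moreover have "\<exists>k\<in>set (k # ks). j = y (2 * k) \<or> j = y (2 * k - 1)" if "c j = 1" for j
    proof (cases "j = y (2 * k) \<or> j = y (2 * k - 1)")
      case False
      then have "(c + ?e) j = 1" using that by (simp add: evec_def)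
      then show ?thesis using IH(2) by auto
    qed auto
    ultimately show ?thesis by blast
  qed
qed

text \<open>The coefficient of v comes only from choosing 1 in every factor: a pair chosen once
  cannot be cancelled, because the list is distinct.\<close>

lemma gam_at_0:
  assumes "inj_on y {1..2 * N}" "set ks \<subseteq> {1..N}" "distinct ks"
  shows "gam I y ks 0 = 1"
  using assms(2,3)
proof (induction ks)
  case Nil
  then show ?case by (auto simp: gam_def M_basis_def)
next
  case (Cons k ks)
  let ?e = "evec (y (2 * k - 1)) + evec (y (2 * k))"
  have k: "k \<in> {1..N}" using Cons.prems by auto
  have "gam I y ks ?e = 0"
  proof (rule ccontr)
    assume "gam I y ks ?e \<noteq> 0"
    moreover have "set ks \<subseteq> {1..N}" using Cons.prems by auto
    ultimately have "?e (y (2 * k)) = 1 \<longrightarrow> (\<exists>l\<in>set ks. y (2 * k) = y (2 * l) \<or> y (2 * k) = y (2 * l - 1))"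
      using gam_support[OF assms(1)] by blast
    moreover have "?e (y (2 * k)) = 1"
      using inj_on_pairs[OF assms(1) k k] by (auto simp: evec_def)
    ultimately obtain l where l: "l \<in> set ks" "y (2 * k) = y (2 * l) \<or> y (2 * k) = y (2 * l - 1)" by auto
    moreover have "l \<in> {1..N}" using Cons.prems l by auto
    ultimately have "k = l" using inj_on_pairs[OF assms(1) k] by auto
    then show False using l Cons.prems by auto
  qed
  then have "(M_C (y (2 * k - 1)) (M_C (y (2 * k)) (gam I y ks))) 0 = 0"
    by (simp add: M_C_def add.assoc)
  then show ?case using Cons by (simp add: gam_Cons fscale_def del: zero_fun_apply)
qed

text \<open>For the factor u = 1 + I C_a C_b one computes C_b u = C_b - I C_a = - I C_a u from I^2 =
  -1. The factors of the other pairs are even and do not involve a or b, so C_a and C_b commute with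
  them.\<close>

lemma M_C_gam:
  assumes "inj_on y {1..2 * N}" "set ks \<subseteq> {1..N}" "k \<in> set ks" "distinct ks" "I * I = - 1"
  shows "M_C (y (2 * k)) (gam I y ks) = (- I) \<cdot> M_C (y (2 * k - 1)) (gam I y ks)"
  using assms(2,3,4)
proof (induction ks)
  case (Cons l ks)
  let ?C = "\<lambda>j. M_C (y j)"
  show ?case
  proof (cases "l = k")
    case True
    let ?f = "gam I y ks"
    have ne: "y (2 * k) \<noteq> y (2 * k - 1)"
      using Cons.prems True inj_on_pairs[OF assms(1), of k k] by auto
    have eq: "?C (2 * k) (?C (2 * k - 1) (?C (2 * k) ?f)) = - ?C (2 * k - 1) ?f"
      unfolding M_C_anticommute[OF ne] by (simp only: M_C_square)
    have 1: "?C (2 * k) (gam I y (l # ks)) = ?C (2 * k) ?f + I \<cdot> (- ?C (2 * k - 1) ?f)"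
      unfolding True by (simp only: gam_Cons M_C_add M_C_scale eq)
    have 2: "?C (2 * k - 1) (gam I y (l # ks)) = ?C (2 * k - 1) ?f + I \<cdot> ?C (2 * k) ?f"
      unfolding True by (simp only: gam_Cons M_C_add M_C_scale M_C_square)
    have "u + I * (- v) = - I * (v + I * u)" for u v
    proof -
      have "- I * (v + I * u) = - (I * v) - (I * I) * u" by (simp add: algebra_simps)
      then show ?thesis by (simp add: assms(5))
    qed
    then show ?thesis
      unfolding 1 2 by (simp only: fun_eq_iff fscale_def plus_fun_apply uminus_apply) blast
  next
    case False
    have k: "k \<in> {1..N}" "l \<in> {1..N}" "k \<in> set ks" using Cons.prems False by auto
    have IH: "?C (2 * k) (gam I y ks) = (- I) \<cdot> ?C (2 * k - 1) (gam I y ks)"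
      using Cons False by auto
    have ne: "y j \<noteq> y (2 * l - 1)" "y j \<noteq> y (2 * l)" if "j = 2 * k \<or> j = 2 * k - 1" for j
      using that False inj_on_pairs[OF assms(1) k(1,2)] by auto
    \<comment> \<open>Two anticommutations, whose signs cancel.\<close>
    have comm: "?C j (?C (2 * l - 1) (?C (2 * l) f)) = ?C (2 * l - 1) (?C (2 * l) (?C j f))"
      if "j = 2 * k \<or> j = 2 * k - 1" for j and f :: "'a mvec"
    proof -
      have n: "M_C i (- f) = - M_C i f" for i and f :: "'a mvec"
        by (simp add: M_C_def fun_eq_iff)
      show ?thesis
        unfolding M_C_anticommute[OF ne(1)[OF that]] M_C_anticommute[OF ne(2)[OF that]] n by simp
    qed
    show ?thesis
      by (simp only: gam_Cons M_C_add M_C_scale comm[OF disjI1[OF refl]] comm[OF disjI2[OF refl]]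
          IH fvec.scale_right_distrib fscale_simps mult.commute[of I "- I"])
  qed
qed auto

section \<open>Tableaux\<close>

lemma finite_comps: "finite (comps bul m)"
  by (cases bul) auto

lemma inj_on_comp_rank: "inj_on comp_rank (comps bul m)"
  by (cases bul) (auto simp: inj_on_def)

lemma boxes_in_comps:
  assumes "lam \<in> mparts bul m n" "(i, j, l) \<in> boxes lam"
  shows "l \<in> comps bul m"
proof (rule ccontr)
  assume "l \<notin> comps bul m"
  then have "lam l = []" using assms(1) by (auto simp: mparts_def)
  then show False using assms(2) by (auto simp: boxes_def)
qed

text \<open>Describing a box by component, row counted from 0 and offset within the row removes the
  shift, so the boxes can be counted as an iterated sum of row lengths.\<close>

lemma boxes_eq_image:
  assumes "lam \<in> mparts bul m n"
  shows "boxes lam = (\<lambda>(l, r, j). (Suc r, if strict_comp l then Suc r + j else Suc j, l)) `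
    (SIGMA l : comps bul m. SIGMA r : {..<length (lam l)}. {..<lam l ! r})"
    (is "_ = ?f ` ?S")
proof (intro equalityI subsetI)
  fix x assume "x \<in> boxes lam"
  then obtain i j l where x: "x = (i, j, l)" "(i, j, l) \<in> boxes lam" by (cases x) auto
  then have l: "l \<in> comps bul m" using boxes_in_comps[OF assms] by blast
  let ?z = "(l, i - 1, if strict_comp l then j - i else j - 1)"
  have "?z \<in> ?S" using x(2) l by (auto simp: boxes_def)
  moreover have "x = ?f ?z" using x by (auto simp: boxes_def)
  ultimately show "x \<in> ?f ` ?S" by blast
next
  fix x assume "x \<in> ?f ` ?S"
  then show "x \<in> boxes lam" by (auto simp: boxes_def)
qed

lemma boxes_card:
  assumes "lam \<in> mparts bul m n"
  shows "finite (boxes lam)" "msize lam = n"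
proof -
  let ?f = "\<lambda>(l, r, j). (Suc r, if strict_comp l then Suc r + j else Suc j, l)"
  let ?S = "SIGMA l : comps bul m. SIGMA r : {..<length (lam l)}. {..<lam l ! r}"
  have fin: "finite ?S" by (intro finite_SigmaI finite_comps) auto
  then show "finite (boxes lam)" unfolding boxes_eq_image[OF assms] by (rule finite_imageI)
  have "inj_on ?f ?S" by (auto simp: inj_on_def split: if_splits)
  then have "msize lam = card ?S"
    unfolding boxes_eq_image[OF assms] by (rule card_image)
  also have "\<dots> = (\<Sum>l\<in>comps bul m. sum_list (lam l))"
    by (subst card_SigmaI)
      (auto simp: finite_comps card_SigmaI sum_list_sum_nth atLeast0LessThan intro!: sum.cong)
  also have "\<dots> = n" using assms by (auto simp: mparts_def)
  finally show "msize lam = n" .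
qed

text \<open>In a finite total order the number of predecessors grows strictly, hence is injective
  with values between 1 and the cardinality.\<close>

lemma bij_betw_rank:
  assumes "finite A" "\<And>x. x \<in> A \<Longrightarrow> r x x"
    and "\<And>x y. x \<in> A \<Longrightarrow> y \<in> A \<Longrightarrow> r x y \<Longrightarrow> r y x \<Longrightarrow> x = y"
    and "\<And>x y z. x \<in> A \<Longrightarrow> y \<in> A \<Longrightarrow> z \<in> A \<Longrightarrow> r x y \<Longrightarrow> r y z \<Longrightarrow> r x z"
    and "\<And>x y. x \<in> A \<Longrightarrow> y \<in> A \<Longrightarrow> r x y \<or> r y x"
  shows "bij_betw (\<lambda>x. card {y \<in> A. r y x}) A {1..card A}"
proof -
  let ?c = "\<lambda>x. card {y \<in> A. r y x}"
  have less: "?c x < ?c y" if "x \<in> A" "y \<in> A" "r x y" "x \<noteq> y" for x y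
  proof (rule psubset_card_mono)
    show "finite {z \<in> A. r z y}" using assms(1) by auto
    have "y \<notin> {z \<in> A. r z x}" using that assms(3)[of x y] by auto
    moreover have "y \<in> {z \<in> A. r z y}" using that assms(2) by auto
    moreover have "{z \<in> A. r z x} \<subseteq> {z \<in> A. r z y}" using that assms(4) by blast
    ultimately show "{z \<in> A. r z x} \<subset> {z \<in> A. r z y}" by blast
  qed
  have inj: "inj_on ?c A"
  proof (rule inj_onI)
    fix x y assume xy: "x \<in> A" "y \<in> A" "?c x = ?c y"
    show "x = y"
      using less[of x y] less[of y x] xy assms(5)[of x y] by (cases "x = y") auto
  qed
  have sub: "?c ` A \<subseteq> {1..card A}"
  proof
    fix k assume "k \<in> ?c ` A"
    then obtain x where x: "x \<in> A" "k = ?c x" by auto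
    have "?c x \<le> card A" using assms(1) by (intro card_mono) auto
    moreover have "{y \<in> A. r y x} \<noteq> {}" using x assms(2) by auto
    then have "?c x > 0" using assms(1) by (simp add: card_gt_0_iff)
    ultimately show "k \<in> {1..card A}" using x by simp
  qed
  have "?c ` A = {1..card A}"
    using card_image[OF inj] sub by (intro card_subset_eq) auto
  then show ?thesis using inj by (simp add: bij_betw_def)
qed

lemma tab_init_bij:
  assumes "lam \<in> mparts bul m n"
  shows "bij_betw (tab_init lam) (boxes lam) {1..n}"
proof -
  \<comment> \<open>Coinciding values of \<open>comp_rank\<close> occur only for components that
    never belong to the same tuple, so the reading order is total on the boxes.\<close>
  have tot: "reads_before x y \<or> reads_before y x" if "x \<in> boxes lam" "y \<in> boxes lam" for x y
  proof -
    obtain i j l i' j' l' where xy: "x = (i, j, l)" "y = (i', j', l')" by (cases x; cases y) auto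
    then have "l \<in> comps bul m" "l' \<in> comps bul m"
      using that boxes_in_comps[OF assms] by blast+
    then have "comp_rank l = comp_rank l' \<Longrightarrow> l = l'"
      using inj_on_comp_rank by (auto dest: inj_onD)
    then show ?thesis unfolding xy by (auto simp: not_less)
  qed
  have "bij_betw (\<lambda>x. card {y \<in> boxes lam. reads_before y x}) (boxes lam) {1..msize lam}"
  proof (rule bij_betw_rank)
    show "finite (boxes lam)" by (rule boxes_card(1)[OF assms])
  qed (use tot in \<open>auto split: prod.splits\<close>)
  then show ?thesis
    unfolding boxes_card(2)[OF assms] by (rule bij_betw_cong[THEN iffD1, rotated]) (simp add: tab_init_def)
qed

lemma tab_init_outside: "x \<notin> boxes lam \<Longrightarrow> tab_init lam x = 0"
  by (simp add: tab_init_def)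

lemma Std_bij:
  assumes "lam \<in> mparts bul m n" "t \<in> Std lam"
  shows "bij_betw t (boxes lam) {1..n}" "x \<notin> boxes lam \<Longrightarrow> t x = 0"
  using assms(2) boxes_card(2)[OF assms(1)] unfolding Std_def by blast+

lemma bij_betw_obtain:
  assumes "bij_betw f A B" "y \<in> B"
  obtains x where "x \<in> A" "y = f x"
  using assms unfolding bij_betw_def by blast

text \<open>The default value 0 off the diagram leaves only finitely many functions to choose
  from.\<close>

lemma finite_Std:
  assumes "lam \<in> mparts bul m n"
  shows "finite (Std lam)"
proof (rule finite_subset)
  show "Std lam \<subseteq> {t. t ` boxes lam \<subseteq> {..n} \<and> (\<forall>x. x \<notin> boxes lam \<longrightarrow> t x = 0)}"
    using Std_bij[OF assms] bij_betwE[OF Std_bij(1)[OF assms]] by fastforce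
  show "finite \<dots>"
    using finite_set_of_finite_funs[OF boxes_card(1)[OF assms] finite_atMost[of n], of 0]
    by (rule rev_finite_subset) auto
qed

section \<open>The permutations d(t, t^\<lambda>), diagonal entries and residues\<close>

lemma dperm_eq:
  assumes lam: "lam \<in> mparts bul m n" and "d permutes {1..n}" "t = d \<circ> tab_init lam"
  shows "dperm lam t (tab_init lam) = d"
  unfolding dperm_def boxes_card(2)[OF lam]
proof (rule the_equality)
  \<comment> \<open>Uniqueness: every k in {1..n} is an entry of the initial tableau, where both
    permutations are determined by t, and elsewhere both are the identity.\<close>
  fix d' assume d': "d' permutes {1..n} \<and> t = d' \<circ> tab_init lam"
  show "d' = d"
  proof
    fix k
    show "d' k = d k"
    proof (cases "k \<in> {1..n}")
      case True
      then obtain x where "k = tab_init lam x"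
        using bij_betw_obtain[OF tab_init_bij[OF lam]] by metis
      then show ?thesis using d' assms(3) by (metis comp_apply)
    next
      case False
      then show ?thesis using d' assms(2) permutes_not_in by metis
    qed
  qed
qed (use assms in auto)

lemma dperm_Std:
  assumes lam: "lam \<in> mparts bul m n" and t: "t \<in> Std lam"
  shows "dperm lam t (tab_init lam) permutes {1..n}" "t = dperm lam t (tab_init lam) \<circ> tab_init lam"
proof -
  \<comment> \<open>The entry of a box in the initial tableau is sent to the entry of the same box
    in t. In particular d fixes 0, which matches the default value off the diagram.\<close>
  define d where "d k = (if k \<in> {1..n} then t (inv_into (boxes lam) (tab_init lam) k) else k)" for k
  have "bij_betw (t \<circ> inv_into (boxes lam) (tab_init lam)) {1..n} {1..n}"
    using bij_betw_inv_into[OF tab_init_bij[OF lam]] Std_bij(1)[OF lam t] by (rule bij_betw_trans)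
  then have "bij_betw d {1..n} {1..n}"
    by (rule bij_betw_cong[THEN iffD1, rotated]) (simp add: d_def)
  then have d: "d permutes {1..n}"
    by (rule bij_imp_permutes) (simp add: d_def del: atLeastAtMost_iff)
  have "t x = d (tab_init lam x)" for x
  proof (cases "x \<in> boxes lam")
    case True
    then have "tab_init lam x \<in> {1..n}" "inv_into (boxes lam) (tab_init lam) (tab_init lam x) = x"
      using tab_init_bij[OF lam] by (auto simp: bij_betw_def)
    then show ?thesis by (simp add: d_def)
  next
    case False
    then show ?thesis by (simp add: d_def tab_init_outside Std_bij(2)[OF lam t])
  qed
  then have "t = d \<circ> tab_init lam" by auto
  with d dperm_eq[OF lam d this]
  show "dperm lam t (tab_init lam) permutes {1..n}" "t = dperm lam t (tab_init lam) \<circ> tab_init lam"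
    by auto
qed

text \<open>The swapped tableau need not be standard, so the permutation is identified through
  \<open>dperm_eq\<close>, which does not ask for standardness.\<close>

lemma dperm_swap:
  assumes "lam \<in> mparts bul m n" "t \<in> Std lam" "1 \<le> i" "Suc i \<le> n"
  shows "dperm lam (swap_tab i t) (tab_init lam) = transpose i (Suc i) \<circ> dperm lam t (tab_init lam)"
proof (rule dperm_eq[OF assms(1)])
  show "transpose i (Suc i) \<circ> dperm lam t (tab_init lam) permutes {1..n}"
    using assms by (intro permutes_compose dperm_Std permutes_swap_id) auto
  show "swap_tab i t = transpose i (Suc i) \<circ> dperm lam t (tab_init lam) \<circ> tab_init lam"
    unfolding swap_tab_def by (subst dperm_Std(2)[OF assms(1,2)]) (simp add: comp_assoc)
qed

lemma Dtab_dperm: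
  assumes "lam \<in> mparts bul m n" "t \<in> Std lam"
  shows "Dtab lam t = dperm lam t (tab_init lam) ` Dtab lam (tab_init lam)"
  unfolding Dtab_def by (subst dperm_Std(2)[OF assms]) (simp add: image_comp)

lemma diag_boxes_subset: "diag_boxes lam \<subseteq> boxes lam"
  by (auto simp: diag_boxes_def)

lemma Dtab_subset:
  assumes "lam \<in> mparts bul m n" "t \<in> Std lam"
  shows "Dtab lam t \<subseteq> {1..n}"
  using Std_bij(1)[OF assms] diag_boxes_subset[of lam] by (auto simp: Dtab_def bij_betw_def)

lemma xp_init:
  assumes "lam \<in> mparts bul m n"
  shows "xp lam (tab_init lam) p = sorted_list_of_set (Dtab lam (tab_init lam)) ! (p - 1)"
  using dperm_eq[OF assms permutes_id, of "tab_init lam"] by (simp add: xp_def)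

lemma xp_dperm:
  assumes "lam \<in> mparts bul m n"
  shows "xp lam t p = dperm lam t (tab_init lam) (xp lam (tab_init lam) p)"
  unfolding xp_init[OF assms] by (simp add: xp_def)

lemma xp_init_bij:
  assumes lam: "lam \<in> mparts bul m n"
  shows "bij_betw (xp lam (tab_init lam)) {1..num_diag lam} (Dtab lam (tab_init lam))"
proof -
  let ?D = "Dtab lam (tab_init lam)"
  let ?Y = "sorted_list_of_set ?D"
  have "inj_on (tab_init lam) (diag_boxes lam)"
    using tab_init_bij[OF lam] diag_boxes_subset by (auto simp: bij_betw_def intro: inj_on_subset)
  then have card: "card ?D = num_diag lam" by (simp add: Dtab_def card_image)
  have "finite ?D"
    using boxes_card(1)[OF lam] diag_boxes_subset[of lam]
    by (auto simp: Dtab_def intro: finite_subset)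
  then have "bij_betw (\<lambda>i. ?Y ! i) {..<num_diag lam} ?D"
    using card by (intro bij_betw_nth) auto
  \<comment> \<open>Diagonal entries are numbered from 1, list positions from 0.\<close>
  moreover have "bij_betw (\<lambda>p. p - 1) {1..num_diag lam} {..<num_diag lam}"
    by (rule bij_betw_byWitness[where f' = Suc]) auto
  ultimately have "bij_betw ((\<lambda>i. ?Y ! i) \<circ> (\<lambda>p. p - 1)) {1..num_diag lam} ?D"
    by (rule bij_betw_trans[rotated])
  then show ?thesis
    by (rule bij_betw_cong[THEN iffD1, rotated]) (simp add: xp_init[OF lam])
qed

lemma xp_bij:
  assumes lam: "lam \<in> mparts bul m n" and t: "t \<in> Std lam"
  shows "bij_betw (xp lam t) {1..num_diag lam} (Dtab lam t)"
proof -
  let ?d = "dperm lam t (tab_init lam)"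
  have "bij_betw ?d (Dtab lam (tab_init lam)) (Dtab lam t)"
    unfolding Dtab_dperm[OF lam t] using permutes_inj[OF dperm_Std(1)[OF lam t]]
    by (intro inj_on_imp_bij_betw) (auto intro: inj_on_subset)
  from bij_betw_trans[OF xp_init_bij[OF lam] this] show ?thesis
    by (rule bij_betw_cong[THEN iffD1, rotated]) (simp add: xp_dperm[OF lam, of t])
qed

lemma ODtab_subset:
  assumes "lam \<in> mparts bul m n" "t \<in> Std lam"
  shows "ODtab lam t \<subseteq> Dtab lam t"
  using xp_bij[OF assms] by (auto simp: ODtab_def bij_betw_def)

text \<open>Since p \<mapsto> x_p is injective, the parity of the index is a property of the entry
  itself.\<close>

lemma xp_mem_ODtab:
  assumes "lam \<in> mparts bul m n" "t \<in> Std lam" "p \<in> {1..num_diag lam}"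
  shows "xp lam t p \<in> ODtab lam t \<longleftrightarrow> odd p"
  using xp_bij[OF assms(1,2)] assms(3) by (auto simp: ODtab_def bij_betw_def dest: inj_onD)

text \<open>Both entries lie in the same box. Thus the eigenvalues on M, defined through the initial
  tableau, become those of t on the twisted summand.\<close>

lemma res_dperm:
  assumes lam: "lam \<in> mparts bul m n" and t: "t \<in> Std lam" and k: "k \<in> {1..n}"
  shows "res q Q lam (tab_init lam) (inv (dperm lam t (tab_init lam)) k) = res q Q lam t k"
proof -
  let ?d = "dperm lam t (tab_init lam)"
  have d: "?d permutes {1..n}" by (rule dperm_Std(1)[OF lam t])
  obtain x where x: "x \<in> boxes lam" "k = t x"
    using bij_betw_obtain[OF Std_bij(1)[OF lam t] k] by metis
  have "inv ?d k = tab_init lam x"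
    using fun_cong[OF dperm_Std(2)[OF lam t], of x] x permutes_inverses(2)[OF d] by simp
  then show ?thesis
    using x tab_init_bij[OF lam] Std_bij(1)[OF lam t] by (simp add: res_def bij_betw_def)
qed

text \<open>On a diagonal box the power of q is trivial, and a strict component has parameter 1 or
  -1.\<close>

lemma res_diag:
  assumes lam: "lam \<in> mparts bul m n" and t: "t \<in> Std lam" and k: "k \<in> Dtab lam t"
  shows "res q Q lam t k = 1 \<or> res q Q lam t k = - 1"
proof -
  obtain i l where "(i, i, l) \<in> boxes lam" "strict_comp l" "k = t (i, i, l)"
    using k by (auto simp: Dtab_def diag_boxes_def)
  then have "res q Q lam t k = Qval Q l"
    using Std_bij(1)[OF lam t] by (simp add: res_def bij_betw_def)
  then show ?thesis using \<open>strict_comp l\<close> by (cases l) auto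
qed

subsection \<open>Adding a box to a first row\<close>

text \<open>Strict decrease compensates the shift by one column per row: no row of a shifted diagram
  extends beyond the first.\<close>

lemma sorted_strict_nth:
  "sorted_wrt (>) (xs :: nat list) \<Longrightarrow> i < length xs \<Longrightarrow> xs ! i + i \<le> xs ! 0"
proof (induction i)
  case (Suc i)
  then have "xs ! Suc i < xs ! i" using sorted_wrt_nth_less[of "(>)" xs i "Suc i"] by simp
  with Suc show ?case by simp
qed simp

lemma separate_res:
  assumes lam: "lam \<in> mparts bul m n" and t: "t \<in> Std lam" and n: "1 \<le> n"
    and sep: "\<forall>mu\<in>mparts bul m (n + 1). separate q Q mu"
    and k: "1 \<le> k" "Suc k \<le> n"
  shows "qfun q (res q Q lam t k) \<noteq> qfun q (res q Q lam t (Suc k))"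
proof -
  \<comment> \<open>A tuple of size n \<ge> 1 needs a component, and this supplies the row to be
    extended.\<close>
  have "comps bul m \<noteq> {}"
  proof
    assume "comps bul m = {}"
    then have "n = 0" using lam by (auto simp: mparts_def)
    then show False using n by simp
  qed
  then obtain l0 where l0: "l0 \<in> comps bul m" by auto
  \<comment> \<open>\<open>a\<close> is the length of the first row of \<open>l0\<close>, or 0 if
    that component is empty. Row 1 of a shifted diagram also starts in column 1, so
    \<open>x0\<close> is the next box of the row in either case.\<close>
  define a where "a = (case lam l0 of [] \<Rightarrow> 0 | x # xs \<Rightarrow> x)"
  define xs where "xs = Suc a # tl (lam l0)"
  define mu where "mu = lam(l0 := xs)"
  define x0 where "x0 = (1 :: nat, Suc a, l0)"
  have part: "if strict_comp l0 then is_strict_partition (lam l0) else is_partition (lam l0)"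
    using lam l0 unfolding mparts_def by blast
  have xs_nth: "xs ! r = lam l0 ! r" if "r \<noteq> 0" "r < length xs" for r
    using that by (cases "lam l0"; cases r) (auto simp: xs_def)
  have len: "length xs = (if lam l0 = [] then 1 else length (lam l0))"
    by (auto simp: xs_def)
  have "if strict_comp l0 then is_strict_partition xs else is_partition xs"
    using part by (cases "lam l0")
      (auto simp: xs_def a_def is_strict_partition_def is_partition_def le_Suc_eq less_Suc_eq)
  moreover have "sum_list xs = Suc (sum_list (lam l0))"
    by (cases "lam l0") (auto simp: xs_def a_def)
  then have "(\<Sum>l\<in>comps bul m. sum_list (mu l)) = n + 1"
    using lam l0 finite_comps[of bul m]
    by (simp add: mparts_def mu_def sum.remove[of _ l0])
  ultimately have mu: "mu \<in> mparts bul m (n + 1)"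
    using lam l0 by (auto simp: mparts_def mu_def)
  have row1: "(1, j, l0) \<in> boxes lam \<longleftrightarrow> 1 \<le> j \<and> j \<le> a" for j
    by (cases "lam l0") (auto simp: boxes_def a_def)
  \<comment> \<open>No box of \<open>l0\<close> lies to the right of the first row's end, so the new
    box is alone in its column and nothing has to be larger than it.\<close>
  have col: "j \<le> a" if "(i, j, l0) \<in> boxes lam" for i j
  proof -
    from that have i: "1 \<le> i" "i - 1 < length (lam l0)" by (auto simp: boxes_def)
    then have a0: "a = lam l0 ! 0" by (cases "lam l0") (auto simp: a_def)
    show ?thesis
    proof (cases "strict_comp l0")
      case True
      then have "lam l0 ! (i - 1) + (i - 1) \<le> a"
        using sorted_strict_nth[OF _ i(2)] part a0 by (auto simp: is_strict_partition_def)
      then show ?thesis using that True i by (auto simp: boxes_def)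
    next
      case False
      then have "lam l0 ! (i - 1) \<le> a"
        using part i a0 sorted_wrt_nth_less[of "(\<ge>)" "lam l0" 0 "i - 1"]
        by (cases "i - 1") (auto simp: is_partition_def)
      then show ?thesis using that False by (auto simp: boxes_def)
    qed
  qed
  have boxes_mu: "boxes mu = insert x0 (boxes lam)"
  proof (rule set_eqI)
    fix x :: box
    obtain i j l where x: "x = (i, j, l)" by (cases x)
    have "x \<in> boxes mu \<longleftrightarrow> x \<in> boxes lam" if "l \<noteq> l0 \<or> i \<noteq> 1"
      using that xs_nth[of "i - 1"] len by (auto simp: x boxes_def mu_def)
    moreover have "(1, j, l0) \<in> boxes mu \<longleftrightarrow> 1 \<le> j \<and> j \<le> Suc a"
      by (auto simp: boxes_def mu_def xs_def)
    ultimately show "x \<in> boxes mu \<longleftrightarrow> x \<in> insert x0 (boxes lam)"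
      using row1[of j] by (auto simp: x x0_def)
  qed
  have x0: "x0 \<notin> boxes lam" using row1 by (simp add: x0_def)
  \<comment> \<open>The new box receives the largest entry, so the tableau stays standard and the
    entries up to n keep their boxes and residues.\<close>
  define u where "u = t(x0 := Suc n)"
  have u_lam: "u x = t x" if "x \<in> boxes lam" for x using that x0 by (auto simp: u_def)
  have tle: "t x < Suc n" if "x \<in> boxes lam" for x
    using bij_betwE[OF Std_bij(1)[OF lam t]] that by fastforce
  have "bij_betw u (boxes lam) {1..n}"
    using Std_bij(1)[OF lam t] by (rule bij_betw_cong[THEN iffD1, rotated]) (simp add: u_lam)
  then have bij: "bij_betw u (boxes mu) {1..Suc n}"
    using notIn_Un_bij_betw[of x0 "boxes lam" u "{1..n}"] x0
    by (simp add: boxes_mu u_def atLeastAtMostSuc_conv)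
  have "u \<in> Std mu"
    unfolding Std_def
  proof (intro CollectI conjI allI impI)
    show "bij_betw u (boxes mu) {1..msize mu}" using bij boxes_card(2)[OF mu] by simp
    show "u x = 0" if "x \<notin> boxes mu" for x
      using that Std_bij(2)[OF lam t] by (auto simp: boxes_mu u_def)
  next
    fix i j j' l assume *: "(i, j, l) \<in> boxes mu \<and> (i, j', l) \<in> boxes mu \<and> j < j'"
    then have "(i, j, l) \<noteq> x0"
      using col[of i j'] by (auto simp: boxes_mu x0_def)
    then have 1: "(i, j, l) \<in> boxes lam" using * by (simp add: boxes_mu)
    show "u (i, j, l) < u (i, j', l)"
    proof (cases "(i, j', l) = x0")
      case True
      then have "u (i, j', l) = Suc n" by (simp add: u_def)
      then show ?thesis using u_lam[OF 1] tle[OF 1] by simp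
    next
      case False
      then have 2: "(i, j', l) \<in> boxes lam" using * by (simp add: boxes_mu)
      show ?thesis using u_lam[OF 1] u_lam[OF 2] 1 2 * t by (simp add: Std_def)
    qed
  next
    fix i i' j l assume *: "(i, j, l) \<in> boxes mu \<and> (i', j, l) \<in> boxes mu \<and> i < i'"
    have "(i', j, l) \<noteq> x0"
      using * by (auto simp: boxes_mu x0_def boxes_def)
    then have 1: "(i', j, l) \<in> boxes lam" using * by (simp add: boxes_mu)
    then have "(i, j, l) \<noteq> x0"
      using col[of i' j] by (auto simp: x0_def)
    then have 2: "(i, j, l) \<in> boxes lam" using * by (simp add: boxes_mu)
    show "u (i, j, l) < u (i', j, l)" using u_lam[OF 1] u_lam[OF 2] 1 2 * t by (simp add: Std_def)
  qed
  have res: "res q Q mu u k = res q Q lam t k" if kn: "k \<in> {1..n}" for k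
  proof -
    obtain x where x: "x \<in> boxes lam" "k = t x"
      using bij_betw_obtain[OF Std_bij(1)[OF lam t] kn] by metis
    then have "inv_into (boxes lam) t k = x" "inv_into (boxes mu) u k = x"
      using Std_bij(1)[OF lam t] bij u_lam[OF x(1)]
        inv_into_f_f[of u "boxes mu" x] by (auto simp: bij_betw_def boxes_mu)
    then show ?thesis by (simp add: res_def)
  qed
  have "qfun q (res q Q mu u k) \<noteq> qfun q (res q Q mu u (Suc k))"
    using sep mu \<open>u \<in> Std mu\<close> k boxes_card(2)[OF mu] unfolding separate_def by auto
  then show ?thesis using res[of k] res[of "Suc k"] k by simp
qed

section \<open>Independence and linearity\<close>

lemma sum_fun_eval: "(\<Sum>i\<in>A. f i) x = (\<Sum>i\<in>A. f i x)"
  by (induction A rule: infinite_finite_induct) simp_all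

text \<open>Evaluation at \<open>pos j\<close> kills every member of the family except the j-th, so
  a linear relation evaluated there has a single surviving term.\<close>

lemma dual_independent:
  fixes f :: "'i \<Rightarrow> 'x \<Rightarrow> 'k::field" and pos :: "'i \<Rightarrow> 'x"
  assumes dual: "\<And>i j. i \<in> A \<Longrightarrow> j \<in> A \<Longrightarrow> f i (pos j) \<noteq> 0 \<longleftrightarrow> i = j"
  shows "inj_on f A" "fvec.independent (f ` A)"
proof -
  show inj: "inj_on f A"
  proof (rule inj_onI)
    fix i j assume ij: "i \<in> A" "j \<in> A" "f i = f j"
    have "f j (pos j) \<noteq> 0" using dual[OF ij(2) ij(2)] by blast
    then have "f i (pos j) \<noteq> 0" unfolding ij(3) .
    then show "i = j" using dual[OF ij(1,2)] by simp
  qed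
  show "fvec.independent (f ` A)"
  proof
    assume "fvec.dependent (f ` A)"
    then obtain S u v where S: "finite S" "S \<subseteq> f ` A" "v \<in> S" "u v \<noteq> 0" "(\<Sum>w\<in>S. u w \<cdot> w) = 0"
      unfolding fvec.dependent_explicit by (elim exE conjE bexE)
    then obtain j where j: "j \<in> A" "v = f j" by blast
    have "u w * w (pos j) = 0" if w: "w \<in> S - {v}" for w
    proof -
      obtain i where i: "i \<in> A" "w = f i" using w S(2) by blast
      moreover have "i \<noteq> j" using w i(2) j(2) by blast
      ultimately have "w (pos j) = 0" using dual[of i j] j(1) by metis
      then show ?thesis by simp
    qed
    then have "(\<Sum>w\<in>S - {v}. u w * w (pos j)) = 0" by (intro sum.neutral ballI)
    moreover have "(\<Sum>w\<in>S. u w \<cdot> w) (pos j) = u v * v (pos j) + (\<Sum>w\<in>S - {v}. u w * w (pos j))"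
      by (simp only: sum_fun_eval fscale_def sum.remove[OF S(1,3)] plus_fun_apply)
    ultimately have "u v * v (pos j) = 0" using S(5) by simp
    moreover have "v (pos j) \<noteq> 0" using dual[OF j(1) j(1)] unfolding j(2) by metis
    ultimately show False using S(4) by simp
  qed
qed

section \<open>Linearity of the operators and their restriction to one summand\<close>

lemma M_X_linear:
  "M_X q Q rt lam k (f + g) = M_X q Q rt lam k f + M_X q Q rt lam k g"
  "M_X q Q rt lam k (c \<cdot> f) = c \<cdot> M_X q Q rt lam k f"
  "M_X q Q rt lam k 0 = 0"
  by (simp_all add: M_X_def fscale_def fun_eq_iff algebra_simps)

lemma M_Xinv_linear:
  "M_Xinv q Q rt lam k (f + g) = M_Xinv q Q rt lam k f + M_Xinv q Q rt lam k g"
  "M_Xinv q Q rt lam k (c \<cdot> f) = c \<cdot> M_Xinv q Q rt lam k f"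
  "M_Xinv q Q rt lam k 0 = 0"
  by (simp_all add: M_Xinv_def fscale_def fun_eq_iff algebra_simps)

lemma M_Xinv_M_C_diff: "i \<noteq> j \<Longrightarrow> M_Xinv q Q rt lam i (M_C j f) = M_C j (M_Xinv q Q rt lam i f)"
  by (auto simp: M_Xinv_def M_C_def fun_eq_iff evec_def mult.left_commute)

lemma part_emb: "part s (emb t z) = (if s = t then z else 0)"
  by (cases "s = t") (simp_all add: part_def emb_def zero_fun_def)

lemma dvec_eqI: "(\<And>s. part s F = part s G) \<Longrightarrow> F = G"
  by (auto simp: part_def fun_eq_iff simp del: split_paired_All)

lemma emb_linear:
  "emb t (f + g) = emb t f + emb t g" "emb t (c \<cdot> f) = c \<cdot> emb t f" "emb t 0 = 0"
  "emb t (f - g) = emb t f - emb t g"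
  by (auto simp: emb_def fun_eq_iff fscale_def)

lemma D_C_emb: "D_C lam k (emb t z) = emb t (M_C (inv (dperm lam t (tab_init lam)) k) z)"
proof (rule dvec_eqI)
  fix s
  have "part s (D_C lam k F) = M_C (inv (dperm lam s (tab_init lam)) k) (part s F)" for F :: "'a dvec"
    by (simp add: D_C_def part_def)
  then show "part s (D_C lam k (emb t z)) = part s (emb t (M_C (inv (dperm lam t (tab_init lam)) k) z))"
    by (cases "s = t") (simp_all only: part_emb if_True if_False simp_thms M_C_zero)
qed

lemma D_X_emb:
  "D_X q Q rt lam k (emb t z) = emb t (M_X q Q rt lam (inv (dperm lam t (tab_init lam)) k) z)"
proof (rule dvec_eqI)
  fix s
  have "part s (D_X q Q rt lam k F) = M_X q Q rt lam (inv (dperm lam s (tab_init lam)) k) (part s F)" for F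
    by (simp add: D_X_def part_def)
  then show "part s (D_X q Q rt lam k (emb t z)) =
      part s (emb t (M_X q Q rt lam (inv (dperm lam t (tab_init lam)) k) z))"
    by (cases "s = t") (simp_all only: part_emb if_True if_False simp_thms M_X_linear)
qed

lemma D_Xinv_emb:
  "D_Xinv q Q rt lam k (emb t z) = emb t (M_Xinv q Q rt lam (inv (dperm lam t (tab_init lam)) k) z)"
proof (rule dvec_eqI)
  fix s
  have "part s (D_Xinv q Q rt lam k F) = M_Xinv q Q rt lam (inv (dperm lam s (tab_init lam)) k) (part s F)" for F
    by (simp add: D_Xinv_def part_def)
  then show "part s (D_Xinv q Q rt lam k (emb t z)) =
      part s (emb t (M_Xinv q Q rt lam (inv (dperm lam t (tab_init lam)) k) z))"
    by (cases "s = t") (simp_all only: part_emb if_True if_False simp_thms M_Xinv_linear)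
qed

lemma D_Cpow_emb:
  "D_Cpow lam b (emb t z) =
    emb t (word (inv (dperm lam t (tab_init lam))) b [1..<Suc (msize lam)] z)"
proof -
  have "foldr (\<lambda>k G. if b k = 1 then D_C lam k G else G) ks (emb t z) =
      emb t (word (inv (dperm lam t (tab_init lam))) b ks z)" for ks
    by (induction ks) (simp_all add: word_Cons D_C_emb)
  then show ?thesis unfolding D_Cpow_def .
qed

section \<open>Parity of weights\<close>

lemma wt_evec_parity:
  assumes "finite {j. b j = 1}" "k \<in> A"
  shows "even (wt (b + evec k) A) \<longleftrightarrow> odd (wt b A)"
proof -
  let ?S = "{j \<in> A. j \<noteq> k \<and> b j = 1}"
  have "finite ?S" by (rule finite_subset[OF _ assms(1)]) auto
  moreover have "{j \<in> A. b j = 1} = (if b k = 1 then insert k ?S else ?S)"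
    "{j \<in> A. (b + evec k) j = 1} = (if b k = 1 then ?S else insert k ?S)"
    using assms(2) by (auto simp: evec_def split: if_splits)
  ultimately show ?thesis unfolding wt_def by (cases "b k = 1") simp_all
qed

lemma wt_lessThan_Suc: "wt b {..<Suc i} = wt b {..<i} + delta b i"
proof -
  have "{j \<in> {..<Suc i}. b j = 1} =
      (if b i = 1 then insert i {j \<in> {..<i}. b j = 1} else {j \<in> {..<i}. b j = 1})"
    by (auto simp: less_Suc_eq)
  then show ?thesis by (simp add: wt_def delta_def)
qed

lemma wt_UNIV_split:
  assumes "finite {j. b j = 1}"
  shows "wt b UNIV = wt b {..i} + wt b {i<..}" "wt b UNIV = wt b {..<i} + wt b {i..}"
proof -
  have u: "{..i} \<union> {i<..} = UNIV" "{..<i} \<union> {i..} = UNIV" by auto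
  show "wt b UNIV = wt b {..i} + wt b {i<..}"
    unfolding u(1)[symmetric] by (rule wt_Un_disjoint[OF assms]) auto
  show "wt b UNIV = wt b {..<i} + wt b {i..}"
    unfolding u(2)[symmetric] by (rule wt_Un_disjoint[OF assms]) auto
qed

section \<open>The module \<open>\<D>(\<lambda>)\<close>\<close>

locale separate_module =
  fixes q :: "'k::field" and Q :: "nat \<Rightarrow> 'k" and rt :: "'k \<Rightarrow> 'k"
    and bul :: bullet and m n :: nat and lam :: mpart
  assumes two: "(2 :: 'k) \<noteq> 0" and rt: "rt a * rt a = a"
    and n: "1 \<le> n" and q0: "q \<noteq> 0" and q2: "q\<^sup>2 \<noteq> - 1"
    and sep: "\<forall>mu\<in>mparts bul m (n + 1). separate q Q mu"
    and lam: "lam \<in> mparts bul m n"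
begin

abbreviation "t\<^sub>0 \<equiv> tab_init lam"
abbreviation "y \<equiv> xp lam (tab_init lam)"
abbreviation "v\<^sub>0 \<equiv> v_init rt lam"
abbreviation "dp t \<equiv> dperm lam t (tab_init lam)"
abbreviation "sg t \<equiv> inv (dp t)"
abbreviation "bp k \<equiv> b_plus q rt (res q Q lam (tab_init lam) k)"
abbreviation "bm k \<equiv> b_minus q rt (res q Q lam (tab_init lam) k)"
abbreviation "b t \<equiv> bt q Q rt lam t"
abbreviation "X k \<equiv> M_X q Q rt lam k"
abbreviation "Xinv k \<equiv> M_Xinv q Q rt lam k"
abbreviation "B t \<equiv> Z2 ({1..n} - Dtab lam t)"
abbreviation "A t \<equiv> Z2 (ODtab lam t)"

text \<open>C^\<beta> C^\<alpha> v_t before embedding: the vector of L whose copy in the summand of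
  t it is.\<close>

definition W :: "tableau \<Rightarrow> (nat \<Rightarrow> bit) \<Rightarrow> (nat \<Rightarrow> bit) \<Rightarrow> 'k mvec" where
  "W t \<beta> \<alpha> = word (sg t) \<beta> [1..<Suc n] (word (sg t) \<alpha> [1..<Suc n] v\<^sub>0)"

lemma CCv_emb: "CCv rt lam t \<beta> \<alpha> = emb t (W t \<beta> \<alpha>)"
  by (simp only: CCv_def W_def vt_def D_Cpow_emb boxes_card(2)[OF lam])

lemma v0_gam: "v\<^sub>0 = inverse (2 ^ (num_diag lam div 2)) \<cdot> gam (rt (- 1)) y [1..<Suc (num_diag lam div 2)]"
  by (simp only: v_init_def gam_def)

lemma y_inj: "inj_on y {1..2 * (num_diag lam div 2)}"
  by (rule inj_on_subset[OF bij_betw_imp_inj_on[OF xp_init_bij[OF lam]]]) auto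

lemma v0_pair:
  assumes "k \<in> {1..num_diag lam div 2}"
  shows "M_C (y (2 * k)) v\<^sub>0 = (- rt (- 1)) \<cdot> M_C (y (2 * k - 1)) v\<^sub>0"
proof -
  have "M_C (y (2 * k)) (gam (rt (- 1)) y [1..<Suc (num_diag lam div 2)]) =
      (- rt (- 1)) \<cdot> M_C (y (2 * k - 1)) (gam (rt (- 1)) y [1..<Suc (num_diag lam div 2)])"
    by (rule M_C_gam[OF y_inj]) (use assms rt in auto)
  then show ?thesis
    by (simp only: v0_gam M_C_scale fscale_simps mult.commute)
qed

lemma v0_at_0: "v\<^sub>0 0 \<noteq> 0"
proof -
  have "gam (rt (- 1)) y [1..<Suc (num_diag lam div 2)] 0 = 1"
    by (rule gam_at_0[OF y_inj]) auto
  then have "v\<^sub>0 0 = inverse (2 ^ (num_diag lam div 2))"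
    unfolding v0_gam fscale_def by (simp only: mult_1_right)
  then show ?thesis using two by (simp del: zero_fun_apply)
qed

lemma v0_support:
  assumes "v\<^sub>0 c \<noteq> 0"
  shows "k \<in> {1..num_diag lam div 2} \<Longrightarrow> c (y (2 * k)) = c (y (2 * k - 1))"
    and "c j = 1 \<Longrightarrow> \<exists>k\<in>{1..num_diag lam div 2}. j = y (2 * k) \<or> j = y (2 * k - 1)"
proof -
  have nz: "gam (rt (- 1)) y [1..<Suc (num_diag lam div 2)] c \<noteq> 0"
    using assms unfolding v0_gam fscale_def by (metis mult_zero_right)
  have set: "set [1..<Suc (num_diag lam div 2)] = {1..num_diag lam div 2}"
    by (simp add: atLeastLessThanSuc_atLeastAtMost del: upt_Suc)
  note * = gam_support[OF y_inj equalityD1[OF set] nz, unfolded set]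
  show "k \<in> {1..num_diag lam div 2} \<Longrightarrow> c (y (2 * k)) = c (y (2 * k - 1))"
    using * by blast
  show "c j = 1 \<Longrightarrow> \<exists>k\<in>{1..num_diag lam div 2}. j = y (2 * k) \<or> j = y (2 * k - 1)"
    using * by blast
qed

lemma y_mem: "p \<in> {1..num_diag lam} \<Longrightarrow> y p \<in> Dtab lam t\<^sub>0"
  using bij_betwE[OF xp_init_bij[OF lam]] by blast

lemma v0_support_Dtab:
  assumes "v\<^sub>0 c \<noteq> 0" "c j = 1"
  shows "j \<in> Dtab lam t\<^sub>0"
proof -
  obtain k where k: "k \<in> {1..num_diag lam div 2}" "j = y (2 * k) \<or> j = y (2 * k - 1)"
    using v0_support(2)[OF assms] by blast
  then have "2 * k \<in> {1..num_diag lam}" "2 * k - 1 \<in> {1..num_diag lam}" by auto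
  then show ?thesis using k(2) y_mem by blast
qed

section \<open>The vectors C^\<beta> C^\<alpha> v_t of one summand: coordinates and
  eigenvalues\<close>

context
  fixes t assumes t: "t \<in> Std lam"
begin

lemma bij_dp: "bij (dp t)"
  by (rule permutes_bij[OF dperm_Std(1)[OF lam t]])

lemma bij_sg: "bij (sg t)"
  by (rule bij_imp_bij_inv[OF bij_dp])

lemma inj_sg: "inj (sg t)"
  by (rule bij_is_inj[OF bij_sg])

lemma inv_sg: "inv (sg t) = dp t"
  by (rule inv_inv_eq[OF bij_dp])

lemma sg_dp [simp]: "sg t (dp t k) = k"
  by (rule inv_f_f[OF bij_is_inj[OF bij_dp]])

lemma dp_sg [simp]: "dp t (sg t k) = k"
  by (rule surj_f_inv_f[OF bij_is_surj[OF bij_dp]])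

lemma xp_dp: "xp lam t p = dp t (y p)"
  by (rule xp_dperm[OF lam])

lemma sg_mem_Dtab: "sg t i \<in> Dtab lam t\<^sub>0 \<longleftrightarrow> i \<in> Dtab lam t"
  unfolding Dtab_dperm[OF lam t] by (metis dp_sg imageE imageI sg_dp)

lemma Dtab_sub: "Dtab lam t \<subseteq> {1..n}" and ODtab_sub: "ODtab lam t \<subseteq> Dtab lam t"
  by (rule Dtab_subset[OF lam t] ODtab_subset[OF lam t])+

lemma B_Z2: "\<beta> \<in> B t \<Longrightarrow> \<beta> \<in> Z2 {1..n}" and A_Z2: "\<alpha> \<in> A t \<Longrightarrow> \<alpha> \<in> Z2 {1..n}"
  using Dtab_sub ODtab_sub by (auto intro: Z2_mono[rotated])

lemma B_zero: "\<beta> \<in> B t \<Longrightarrow> i \<in> Dtab lam t \<Longrightarrow> \<beta> i = 0"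
  and A_zero: "\<alpha> \<in> A t \<Longrightarrow> i \<notin> ODtab lam t \<Longrightarrow> \<alpha> i = 0"
  by (auto intro: Z2_eq_0)

text \<open>The two words are signed translations, and their relabelling \<open>sg t\<close> has
  inverse \<open>dp t\<close>; composed, they translate by \<beta> + \<alpha> pulled back along
  d.\<close>

lemma W_coord:
  assumes "\<beta> \<in> B t" "\<alpha> \<in> A t"
  obtains s :: "(nat \<Rightarrow> bit) \<Rightarrow> 'k" where "\<And>c. s c = 1 \<or> s c = - 1"
    "\<And>c. W t \<beta> \<alpha> c = s c * v\<^sub>0 (c + ((\<beta> + \<alpha>) \<circ> dp t))"
proof -
  obtain s1 :: "(nat \<Rightarrow> bit) \<Rightarrow> 'k" where s1: "\<And>c. s1 c = 1 \<or> s1 c = - 1"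
    "\<And>f c. word (sg t) \<beta> [1..<Suc n] f c = s1 c * f (c + (\<beta> \<circ> dp t))"
    using word_coord[OF bij_sg B_Z2[OF assms(1)]] unfolding inv_sg by blast
  obtain s2 :: "(nat \<Rightarrow> bit) \<Rightarrow> 'k" where s2: "\<And>c. s2 c = 1 \<or> s2 c = - 1"
    "\<And>f c. word (sg t) \<alpha> [1..<Suc n] f c = s2 c * f (c + (\<alpha> \<circ> dp t))"
    using word_coord[OF bij_sg A_Z2[OF assms(2)]] unfolding inv_sg by blast
  have "c + (\<beta> \<circ> dp t) + (\<alpha> \<circ> dp t) = c + ((\<beta> + \<alpha>) \<circ> dp t)" for c
    by (simp only: fun_eq_iff plus_fun_apply o_apply add.assoc simp_thms)
  then have "W t \<beta> \<alpha> c = (s1 c * s2 (c + (\<beta> \<circ> dp t))) * v\<^sub>0 (c + ((\<beta> + \<alpha>) \<circ> dp t))" for c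
    by (simp only: W_def s1(2) s2(2) mult.assoc)
  moreover have "s1 c * s2 (c + (\<beta> \<circ> dp t)) = 1 \<or> s1 c * s2 (c + (\<beta> \<circ> dp t)) = - 1" for c
    using s1(1)[of c] s2(1)[of "c + (\<beta> \<circ> dp t)"] by auto
  ultimately show thesis using that[of "\<lambda>c. s1 c * s2 (c + (\<beta> \<circ> dp t))"] by blast
qed

text \<open>The test point belonging to (\<beta>', \<alpha>') sees, up to sign, the coordinate of
  \<gamma> v at the difference c of the two exponents. The three steps are: c vanishes on
  even-numbered diagonal entries, then everywhere, and c = 0 determines both exponents.\<close>

lemma W_dual:
  assumes "\<beta> \<in> B t" "\<alpha> \<in> A t" "\<beta>' \<in> B t" "\<alpha>' \<in> A t"
  shows "W t \<beta> \<alpha> ((\<beta>' + \<alpha>') \<circ> dp t) \<noteq> 0 \<longleftrightarrow> \<beta> = \<beta>' \<and> \<alpha> = \<alpha>'"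
proof -
  obtain s :: "(nat \<Rightarrow> bit) \<Rightarrow> 'k" where s: "\<And>c. s c = 1 \<or> s c = - 1"
    "\<And>c. W t \<beta> \<alpha> c = s c * v\<^sub>0 (c + ((\<beta> + \<alpha>) \<circ> dp t))"
    using W_coord[OF assms(1,2)] by blast
  define c where "c = ((\<beta>' + \<alpha>') \<circ> dp t) + ((\<beta> + \<alpha>) \<circ> dp t)"
  have c: "c j = (\<beta>' (dp t j) + \<beta> (dp t j)) + (\<alpha>' (dp t j) + \<alpha> (dp t j))" for j
    by (simp only: c_def plus_fun_apply o_apply) (simp only: ac_simps)
  have nz: "W t \<beta> \<alpha> ((\<beta>' + \<alpha>') \<circ> dp t) \<noteq> 0 \<longleftrightarrow> v\<^sub>0 c \<noteq> 0"
    using s(1)[of "(\<beta>' + \<alpha>') \<circ> dp t"] unfolding s(2) c_def by auto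
  have "\<beta> = \<beta>' \<and> \<alpha> = \<alpha>'" if v: "v\<^sub>0 c \<noteq> 0"
  proof -
    \<comment> \<open>An even-numbered diagonal entry is excluded from the \<beta> because it is
      diagonal, and from the \<alpha> because its index is even.\<close>
    have even0: "c (y (2 * k)) = 0" if k: "k \<in> {1..num_diag lam div 2}" for k
    proof -
      have p: "2 * k \<in> {1..num_diag lam}" using k by auto
      have "xp lam t (2 * k) \<in> Dtab lam t" "xp lam t (2 * k) \<notin> ODtab lam t"
        using bij_betwE[OF xp_bij[OF lam t]] p xp_mem_ODtab[OF lam t p] by auto
      then show ?thesis
        using assms B_zero A_zero unfolding c xp_dp by simp
    qed
    \<comment> \<open>Exponents occurring in \<gamma> v consist of whole pairs, so a zero at the
      second member forces one at the first. An unpaired last diagonal entry does not occur at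
      all.\<close>
    have "c j = 0" for j
    proof (rule ccontr)
      assume "c j \<noteq> 0"
      then have "c j = 1" by simp
      then obtain k where k: "k \<in> {1..num_diag lam div 2}" "j = y (2 * k) \<or> j = y (2 * k - 1)"
        using v0_support(2)[OF v] by blast
      then have "c j = 0" using even0[OF k(1)] v0_support(1)[OF v k(1)] by auto
      then show False using \<open>c j = 1\<close> by simp
    qed
    then have z: "(\<beta>' i + \<beta> i) + (\<alpha>' i + \<alpha> i) = 0" for i
      using c[of "sg t i"] by simp
    \<comment> \<open>The \<beta> live off the diagonal and the \<alpha> on it, so their sum
      separates.\<close>
    have "\<beta> i = \<beta>' i \<and> \<alpha> i = \<alpha>' i" for i
    proof (cases "i \<in> Dtab lam t")
      case True
      then show ?thesis
        using z[of i] B_zero[OF assms(1) True] B_zero[OF assms(3) True]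
        by (cases "\<alpha> i"; cases "\<alpha>' i") simp_all
    next
      case False
      then have "i \<notin> ODtab lam t" using ODtab_sub by blast
      then show ?thesis
        using z[of i] A_zero[OF assms(2)] A_zero[OF assms(4)]
        by (cases "\<beta> i"; cases "\<beta>' i") simp_all
    qed
    then show ?thesis by blast
  qed
  moreover have "v\<^sub>0 c \<noteq> 0" if "\<beta> = \<beta>' \<and> \<alpha> = \<alpha>'"
  proof -
    have "c = 0" using that unfolding c_def by (simp only: exp_add_self)
    then show ?thesis using v0_at_0 by (simp only:) simp
  qed
  ultimately show ?thesis using nz by blast
qed

lemma bt_eq:
  assumes "i \<in> {1..n}"
  shows "bm (sg t i) = b t i" "bp (sg t i) = inverse (b t i)"
proof -
  show 1: "bm (sg t i) = b t i"
    by (simp only: bt_def res_dperm[OF lam t assms])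
  have "bp (sg t i) * bm (sg t i) = 1"
    by (rule b_plus_b_minus[OF two]) (simp add: power2_eq_square rt)
  then show "bp (sg t i) = inverse (b t i)"
    unfolding 1 by (rule inverse_unique[symmetric, OF trans[OF mult.commute]])
qed

text \<open>At residue 1 or -1 the value of \<open>qfun\<close> is 2 or -2, so the term under the
  root in \<open>b_minus\<close> vanishes.\<close>

lemma bt_diag:
  assumes "i \<in> Dtab lam t"
  shows "b t i = 1 \<or> b t i = - 1"
proof -
  \<comment> \<open>The denominator of \<open>qfun\<close> is nonzero because q^2 \<noteq>
    -1.\<close>
  have "q + inverse q \<noteq> 0"
  proof
    assume "q + inverse q = 0"
    then have "q * (q + inverse q) = 0" by simp
    then have "q\<^sup>2 + 1 = 0" using q0 by (simp add: power2_eq_square algebra_simps)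
    then show False using q2 by (simp add: add_eq_0_iff2)
  qed
  then have "qfun q 1 = 2" "qfun q (- 1) = - 2"
    by (simp_all add: qfun_def divide_simps)
  moreover have "rt 0 = 0" using rt[of 0] by simp
  moreover have "(4 :: 'k) = 2 * 2" by simp
  then have "(4 :: 'k) \<noteq> 0" using two by (simp only: mult_eq_0_iff simp_thms)
  ultimately have "b_minus q rt 1 = 1" "b_minus q rt (- 1) = - 1"
    using two by (simp_all add: b_minus_def)
  then show ?thesis
    using res_diag[OF lam t assms, of q Q] unfolding bt_def by metis
qed

text \<open>\<gamma> v involves only diagonal letters, so off the diagonal all terms of the vector
  carry the same exponent \<beta>_i.\<close>

lemma W_eigen_coord:
  assumes "\<beta> \<in> B t" "\<alpha> \<in> A t" "i \<notin> Dtab lam t" "W t \<beta> \<alpha> c \<noteq> 0"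
  shows "c (sg t i) = \<beta> i"
proof -
  obtain s :: "(nat \<Rightarrow> bit) \<Rightarrow> 'k" where s: "\<And>c. W t \<beta> \<alpha> c = s c * v\<^sub>0 (c + ((\<beta> + \<alpha>) \<circ> dp t))"
    using W_coord[OF assms(1,2)] by blast
  have "v\<^sub>0 (c + ((\<beta> + \<alpha>) \<circ> dp t)) \<noteq> 0" using assms(4) s[of c] by (metis mult_zero_right)
  moreover have "sg t i \<notin> Dtab lam t\<^sub>0" using assms(3) sg_mem_Dtab by blast
  ultimately have "(c + ((\<beta> + \<alpha>) \<circ> dp t)) (sg t i) \<noteq> 1"
    using v0_support_Dtab by blast
  moreover have "\<alpha> i = 0" using A_zero[OF assms(2)] ODtab_sub assms(3) by blast
  ultimately show ?thesis by (cases "c (sg t i)"; cases "\<beta> i") simp_all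
qed

text \<open>Off the diagonal, \<beta>_i decides which of the two inverse eigenvalues occurs. On the
  diagonal b is 1 or -1 and equals its inverse, so the mixture of exponents in \<gamma> v does no
  harm.\<close>

lemma W_X:
  assumes "\<beta> \<in> B t" "\<alpha> \<in> A t" "i \<in> {1..n}"
  shows "X (sg t i) (W t \<beta> \<alpha>) = (b t i powi (- nu \<beta> i)) \<cdot> W t \<beta> \<alpha>"
    and "Xinv (sg t i) (W t \<beta> \<alpha>) = (b t i powi nu \<beta> i) \<cdot> W t \<beta> \<alpha>"
proof -
  have "(if c (sg t i) = 0 then bp (sg t i) else bm (sg t i)) = b t i powi (- nu \<beta> i) \<and>
      (if c (sg t i) = 0 then bm (sg t i) else bp (sg t i)) = b t i powi nu \<beta> i"
    if c: "W t \<beta> \<alpha> c \<noteq> 0" for c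
  proof (cases "i \<in> Dtab lam t")
    case True
    then have "inverse (b t i) = b t i" "b t i powi nu \<beta> i = b t i" "b t i powi (- nu \<beta> i) = b t i"
      using bt_diag[OF True] by (auto simp: nu_def power_int_minus)
    then show ?thesis by (simp add: bt_eq[OF assms(3)])
  next
    case False
    then show ?thesis
      using W_eigen_coord[OF assms(1,2) False c]
      by (simp add: bt_eq[OF assms(3)] nu_def power_int_minus)
  qed
  then have "(if c (sg t i) = 0 then bp (sg t i) else bm (sg t i)) * W t \<beta> \<alpha> c =
        b t i powi (- nu \<beta> i) * W t \<beta> \<alpha> c \<and>
      (if c (sg t i) = 0 then bm (sg t i) else bp (sg t i)) * W t \<beta> \<alpha> c =
        b t i powi nu \<beta> i * W t \<beta> \<alpha> c" for c
    by (cases "W t \<beta> \<alpha> c = 0") (simp_all only: mult_zero_right simp_thms)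
  then show "X (sg t i) (W t \<beta> \<alpha>) = (b t i powi (- nu \<beta> i)) \<cdot> W t \<beta> \<alpha>"
    "Xinv (sg t i) (W t \<beta> \<alpha>) = (b t i powi nu \<beta> i) \<cdot> W t \<beta> \<alpha>"
    unfolding M_X_def M_Xinv_def fscale_def by (simp_all only:)
qed

section \<open>The action of the C_i on one summand\<close>

lemma finite_supp:
  assumes "\<beta> \<in> B t" shows "finite {k. \<beta> k = 1}"
  by (rule finite_supp_Z2[OF assms]) simp

lemma finite_supp':
  assumes "\<alpha> \<in> A t" shows "finite {k. \<alpha> k = 1}"
  by (rule finite_supp_Z2[OF A_Z2[OF assms]]) simp

lemma W_C_off:
  assumes "\<beta> \<in> B t" "i \<in> {1..n} - Dtab lam t"
  shows "M_C (sg t i) (W t \<beta> \<alpha>) = (- 1) ^ wt \<beta> {..<i} \<cdot> W t (\<beta> + evec i) \<alpha>"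
  unfolding W_def by (rule M_C_word_insert[OF inj_sg B_Z2[OF assms(1)]]) (use assms(2) in blast)

lemma xp_mem: "p \<in> {1..num_diag lam} \<Longrightarrow> xp lam t p \<in> Dtab lam t"
  using bij_betwE[OF xp_bij[OF lam t]] by blast

lemma W_C_pass:
  assumes "\<beta> \<in> B t" "i \<in> Dtab lam t"
  shows "M_C (sg t i) (W t \<beta> \<alpha>) =
    (- 1) ^ wt \<beta> UNIV \<cdot> word (sg t) \<beta> [1..<Suc n] (M_C (sg t i) (word (sg t) \<alpha> [1..<Suc n] v\<^sub>0))"
  unfolding W_def by (rule M_C_word_pass[OF inj_sg B_Z2[OF assms(1)] B_zero[OF assms]])

lemma W_C_odd:
  assumes "\<beta> \<in> B t" "\<alpha> \<in> A t" "p \<in> {1..num_diag lam}" "odd p" "i = xp lam t p"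
  shows "M_C (sg t i) (W t \<beta> \<alpha>) = (- 1) ^ (wt \<beta> UNIV + wt \<alpha> {..<i}) \<cdot> W t \<beta> (\<alpha> + evec i)"
proof -
  have i: "i \<in> Dtab lam t" "i \<in> {1..n}" using xp_mem[OF assms(3)] Dtab_sub assms(5) by auto
  show ?thesis
    unfolding W_C_pass[OF assms(1) i(1)] M_C_word_insert[OF inj_sg A_Z2[OF assms(2)] i(2)]
    by (simp only: word_scale fscale_simps power_add W_def)
qed

text \<open>C_i occurs in neither word, so it passes both and reaches \<gamma> v. There it is traded
  for - \<open>rt (-1)\<close> times the C of its odd partner, which is inserted into C^\<alpha>
  from the right.\<close>

lemma W_C_even:
  assumes "\<beta> \<in> B t" "\<alpha> \<in> A t" "p \<in> {1..num_diag lam}" "even p" "i = xp lam t p"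
  shows "M_C (sg t i) (W t \<beta> \<alpha>) =
    (- rt (- 1) * (- 1) ^ (wt \<beta> UNIV + wt \<alpha> {..xp lam t (p - 1)})) \<cdot> W t \<beta> (\<alpha> + evec (xp lam t (p - 1)))"
proof -
  let ?a = "xp lam t (p - 1)"
  obtain k where k: "p = 2 * k" using assms(4) by blast
  have kN: "k \<in> {1..num_diag lam div 2}" and p1: "p - 1 \<in> {1..num_diag lam}" using assms(3) k by auto
  have i: "i \<in> Dtab lam t" "i \<notin> ODtab lam t"
    using xp_mem[OF assms(3)] xp_mem_ODtab[OF lam t assms(3)] assms(4,5) by auto
  have a: "?a \<in> {1..n}" using xp_mem[OF p1] Dtab_sub by blast
  have "M_C (sg t i) v\<^sub>0 = (- rt (- 1)) \<cdot> M_C (sg t ?a) v\<^sub>0"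
    unfolding assms(5) xp_dp sg_dp k by (rule v0_pair[OF kN])
  then have "M_C (sg t i) (W t \<beta> \<alpha>) =
      ((- 1) ^ wt \<beta> UNIV * ((- 1) ^ wt \<alpha> UNIV * (- rt (- 1) * (- 1) ^ wt \<alpha> {?a<..}))) \<cdot> W t \<beta> (\<alpha> + evec ?a)"
    unfolding W_C_pass[OF assms(1) i(1)] M_C_word_pass[OF inj_sg A_Z2[OF assms(2)] A_zero[OF assms(2) i(2)]]
    by (simp only: word_scale word_M_C_insert[OF inj_sg A_Z2[OF assms(2)] a] fscale_simps W_def mult.assoc)
  \<comment> \<open>Passing out contributes |\<alpha>| and re-entering |\<alpha>|_{>a}, together
    |\<alpha>|_{\<le>a} modulo 2.\<close>
  moreover have "(- 1 :: 'k) ^ wt \<beta> UNIV * ((- 1) ^ wt \<alpha> UNIV * (- rt (- 1) * (- 1) ^ wt \<alpha> {?a<..})) =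
      - rt (- 1) * (- 1) ^ (wt \<beta> UNIV + wt \<alpha> {..?a})"
    unfolding wt_UNIV_split(1)[OF finite_supp'[OF assms(2)], of ?a] power_add
    by (simp add: algebra_simps)
  ultimately show ?thesis by (simp only:)
qed

lemma evec_B: "\<beta> \<in> B t \<Longrightarrow> i \<in> {1..n} \<Longrightarrow> i \<notin> Dtab lam t \<Longrightarrow> \<beta> + evec i \<in> B t"
  by (intro Z2_add evec_Z2) auto

lemma evec_A: "\<alpha> \<in> A t \<Longrightarrow> p \<in> {1..num_diag lam} \<Longrightarrow> odd p \<Longrightarrow> \<alpha> + evec (xp lam t p) \<in> A t"
  by (intro Z2_add evec_Z2) (simp_all add: xp_mem_ODtab[OF lam t])

end

section \<open>The submodule L as a span\<close>

lemma L_mod_closed: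
  shows "fvec.subspace (L_mod q Q rt lam)" "v\<^sub>0 \<in> L_mod q Q rt lam"
    and "k \<in> {1..n} \<Longrightarrow> z \<in> L_mod q Q rt lam \<Longrightarrow> M_C k z \<in> L_mod q Q rt lam"
proof -
  show "fvec.subspace (L_mod q Q rt lam)"
    unfolding L_mod_def by (rule fvec.subspace_Inter) blast
  show "v\<^sub>0 \<in> L_mod q Q rt lam"
    unfolding L_mod_def by blast
  show "M_C k z \<in> L_mod q Q rt lam" if "k \<in> {1..n}" "z \<in> L_mod q Q rt lam"
    using that unfolding L_mod_def boxes_card(2)[OF lam] by blast
qed

text \<open>The preimage of a span under a linear map is a subspace, so generators suffice. Source
  and target may differ, as needed for \<open>emb t\<close>.\<close>

lemma span_closed:
  assumes "\<And>f g. T (f + g) = T f + T g" "\<And>c f. T (c \<cdot> f) = c \<cdot> T f" "T 0 = 0"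
    and "\<And>g. g \<in> G \<Longrightarrow> T g \<in> fvec.span H" and "z \<in> fvec.span G"
  shows "T z \<in> fvec.span H"
proof -
  have "fvec.subspace {z. T z \<in> fvec.span H}"
    unfolding fvec.subspace_def mem_Collect_eq assms(1-3)
    using fvec.span_zero fvec.span_add fvec.span_scale by blast
  moreover have "G \<subseteq> {z. T z \<in> fvec.span H}" using assms(4) by blast
  ultimately show ?thesis using fvec.span_minimal assms(5) by blast
qed

context
  fixes t assumes t: "t \<in> Std lam"
begin

lemma sg_range: "i \<in> {1..n} \<Longrightarrow> sg t i \<in> {1..n}"
  using permutes_inv[OF dperm_Std(1)[OF lam t]] by (simp only: permutes_in_image)

lemma W_zero: "W t 0 0 = v\<^sub>0"
  by (simp only: W_def word_zero)

lemma W_in_L: "W t \<beta> \<alpha> \<in> L_mod q Q rt lam"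
proof -
  have "word (sg t) b ks z \<in> L_mod q Q rt lam"
    if "z \<in> L_mod q Q rt lam" "set ks \<subseteq> {1..n}" for b ks z
    using that(2) by (induction ks) (simp_all add: word_Cons that(1) L_mod_closed(3) sg_range del: atLeastAtMost_iff One_nat_def)
  moreover have "set [1..<Suc n] \<subseteq> {1..n}" by (simp add: atLeastLessThanSuc_atLeastAtMost del: upt_Suc)
  ultimately show ?thesis unfolding W_def using L_mod_closed(2) by blast
qed

text \<open>The span contains \<gamma> v and is stable under all generators, while L is the least
  such subspace. Every standard t yields a spanning family of the same L, with labels
  permuted.\<close>

lemma L_mod_eq_span: "L_mod q Q rt lam = fvec.span ((\<lambda>(\<beta>, \<alpha>). W t \<beta> \<alpha>) ` (B t \<times> A t))"
    (is "_ = fvec.span ?G")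
proof
  have W_span: "c \<cdot> W t \<beta> \<alpha> \<in> fvec.span ?G" if "\<beta> \<in> B t" "\<alpha> \<in> A t" for c \<beta> \<alpha>
    using that by (intro fvec.span_scale fvec.span_base) blast
  have C: "M_C (sg t i) (W t \<beta> \<alpha>) \<in> fvec.span ?G"
    if \<beta>: "\<beta> \<in> B t" and \<alpha>: "\<alpha> \<in> A t" and i: "i \<in> {1..n}" for \<beta> \<alpha> i
  proof (cases "i \<in> Dtab lam t")
    case False
    then have "\<beta> + evec i \<in> B t" using evec_B[OF t \<beta> i] by blast
    then show ?thesis
      using W_C_off[OF t \<beta>, of i \<alpha>] i False W_span[OF _ \<alpha>] by (metis DiffI)
  next
    case True
    then obtain p where p: "p \<in> {1..num_diag lam}" "i = xp lam t p"
      using bij_betw_obtain[OF xp_bij[OF lam t]] by metis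
    show ?thesis
    proof (cases "odd p")
      case True
      have "\<alpha> + evec i \<in> A t" unfolding p(2) by (rule evec_A[OF t \<alpha> p(1) True])
      then show ?thesis using W_C_odd[OF t \<beta> \<alpha> p(1) True p(2)] W_span[OF \<beta>] by metis
    next
      case False
      then have "p - 1 \<in> {1..num_diag lam}" "odd (p - 1)" using p(1) by (auto elim!: evenE)
      then have "\<alpha> + evec (xp lam t (p - 1)) \<in> A t" by (rule evec_A[OF t \<alpha>])
      moreover have "even p" using False by blast
      ultimately show ?thesis using W_C_even[OF t \<beta> \<alpha> p(1) _ p(2)] W_span[OF \<beta>] by metis
    qed
  qed
  have gen: "M_C k z \<in> fvec.span ?G" "X k z \<in> fvec.span ?G" "Xinv k z \<in> fvec.span ?G"
    if k: "k \<in> {1..n}" and z: "z \<in> fvec.span ?G" for k z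
  proof -
    \<comment> \<open>Every operator of M is of the form \<open>sg t i\<close>, so the formulas for
      the summand of t apply.\<close>
    define i where "i = dp t k"
    have i: "i \<in> {1..n}" "k = sg t i"
      using k dperm_Std(1)[OF lam t] by (simp_all only: i_def permutes_in_image sg_dp[OF t])
    show "M_C k z \<in> fvec.span ?G" unfolding i(2)
      by (rule span_closed[OF M_C_add M_C_scale M_C_zero _ z]) (use C[OF _ _ i(1)] in force)
    show "X k z \<in> fvec.span ?G" unfolding i(2)
      by (rule span_closed[OF M_X_linear _ z]) (use W_X(1)[OF t _ _ i(1)] W_span in force)
    show "Xinv k z \<in> fvec.span ?G" unfolding i(2)
      by (rule span_closed[OF M_Xinv_linear _ z]) (use W_X(2)[OF t _ _ i(1)] W_span in force)
  qed
  have "v\<^sub>0 \<in> fvec.span ?G"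
    using W_span[OF Z2_0 Z2_0, of 1] by (simp only: W_zero fscale_simps)
  with gen show "L_mod q Q rt lam \<subseteq> fvec.span ?G"
    unfolding L_mod_def boxes_card(2)[OF lam] using fvec.subspace_span by (intro Inter_lower) blast
  show "fvec.span ?G \<subseteq> L_mod q Q rt lam"
    by (rule fvec.span_minimal[OF _ L_mod_closed(1)]) (use W_in_L in auto)
qed

text \<open>The sum of b and its inverse is \<open>qfun\<close> of the residue. If the product were
  1, both entries would have the same such sum, against separateness.\<close>

lemma eigenvalue_neq_1:
  assumes i: "1 \<le> i" "Suc i \<le> n"
    and "e = b t i \<or> e = inverse (b t i)" "e' = b t (Suc i) \<or> e' = inverse (b t (Suc i))"
  shows "e * e' \<noteq> 1"
proof
  assume 1: "e * e' = 1"
  have q: "b t k + inverse (b t k) = qfun q (res q Q lam t k)" if k: "k \<in> {1..n}" for k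
  proof -
    have "b t k + inverse (b t k) = bm (sg t k) + bp (sg t k)"
      by (simp only: bt_eq[OF t k])
    also have "\<dots> = qfun q (res q Q lam t\<^sub>0 (sg t k))"
      using two by (simp add: b_plus_def b_minus_def field_simps)
    finally show ?thesis by (simp only: res_dperm[OF lam t k])
  qed
  have "e' = inverse e" using 1 by (rule inverse_unique[symmetric])
  moreover have "e + inverse e = b t i + inverse (b t i)"
    "e' + inverse e' = b t (Suc i) + inverse (b t (Suc i))"
    using assms(3,4) by (auto simp: add.commute)
  ultimately have "qfun q (res q Q lam t i) = qfun q (res q Q lam t (Suc i))"
    using q[of i] q[of "Suc i"] i by (simp add: add.commute)
  then show False using separate_res[OF lam t n sep i] by blast
qed

lemma powi_nu: "b t i powi nu \<beta> i = b t i \<or> b t i powi nu \<beta> i = inverse (b t i)"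
  "b t i powi (- nu \<beta> i) = b t i \<or> b t i powi (- nu \<beta> i) = inverse (b t i)"
  by (auto simp: nu_def power_int_minus)

text \<open>A fraction in T_i inverts an operator that is diagonal in coordinates. Nonzero entries
  \<open>a\<close> make it injective on the summand, so on an eigenvector the chosen preimage must
  be the rescaled vector, which again lies in L.\<close>

lemma inv_into_emb:
  assumes F: "\<And>z. F (emb t z) = emb t (\<lambda>c. a c * z c)" and a: "\<And>c. a c \<noteq> 0"
    and u: "u \<in> L_mod q Q rt lam" "(\<lambda>c. a c * u c) = \<kappa> \<cdot> u" and \<kappa>: "\<kappa> \<noteq> 0"
  shows "inv_into (emb t ` L_mod q Q rt lam) F (emb t u) = inverse \<kappa> \<cdot> emb t u"
proof (rule inv_into_f_eq)
  show "inj_on F (emb t ` L_mod q Q rt lam)"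
  proof (rule inj_onI, elim imageE)
    fix x x' z z' assume "F x = F x'" "x = emb t z" "x' = emb t z'"
    then have "part t (emb t (\<lambda>c. a c * z c)) = part t (emb t (\<lambda>c. a c * z' c))"
      by (simp only: F)
    then have "a c * z c = a c * z' c" for c
      unfolding part_emb by (simp only: if_True simp_thms fun_eq_iff)
    then have "z c = z' c" for c using a by (metis mult_left_cancel)
    then have "z = z'" by (rule ext)
    then show "x = x'" using \<open>x = emb t z\<close> \<open>x' = emb t z'\<close> by blast
  qed
  have "inverse \<kappa> \<cdot> u \<in> L_mod q Q rt lam"
    using u(1) L_mod_closed(1) by (simp only: fvec.subspace_scale)
  then show "inverse \<kappa> \<cdot> emb t u \<in> emb t ` L_mod q Q rt lam"
    unfolding emb_linear(2)[symmetric] by (rule imageI)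
  have "a c * (inverse \<kappa> * u c) = u c" for c
  proof -
    have "a c * u c = \<kappa> * u c" using u(2) unfolding fscale_def by meson
    then have "inverse \<kappa> * (a c * u c) = inverse \<kappa> * (\<kappa> * u c)" by (simp only:)
    also have "\<dots> = u c" using \<kappa> by simp
    finally show ?thesis by (simp only: mult.left_commute)
  qed
  then have "(\<lambda>c. a c * (inverse \<kappa> \<cdot> u) c) = u"
    unfolding fscale_def by (rule ext)
  then show "F (inverse \<kappa> \<cdot> emb t u) = emb t u"
    unfolding emb_linear(2)[symmetric] F by (simp only:)
qed

end

section \<open>The action of T_i\<close>

context
  fixes t i assumes t: "t \<in> Std lam" and i: "1 \<le> i" "Suc i \<le> n"
begin

lemma i_range: "i \<in> {1..n}" "Suc i \<in> {1..n}"
  using i by simp_all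

lemma inv_into_X_Xinv:
  assumes "u \<in> L_mod q Q rt lam" "X (sg t i) (Xinv (sg t (Suc i)) u) = \<kappa> \<cdot> u" "\<kappa> \<noteq> 1"
  shows "inv_into (emb t ` L_mod q Q rt lam)
      (\<lambda>w. D_X q Q rt lam i (D_Xinv q Q rt lam (Suc i) w) - w) (emb t u) = inverse (\<kappa> - 1) \<cdot> emb t u"
proof (rule inv_into_emb)
  \<comment> \<open>The diagonal entry of X_i X_{i+1}^{-1} - 1 at coordinate c; below it is nonzero
    by \<open>eigenvalue_neq_1\<close>.\<close>
  let ?a = "\<lambda>c. (if c (sg t i) = 0 then bp (sg t i) else bm (sg t i)) *
    (if c (sg t (Suc i)) = 0 then bm (sg t (Suc i)) else bp (sg t (Suc i))) - 1"
  have a: "X (sg t i) (Xinv (sg t (Suc i)) z) - z = (\<lambda>c. ?a c * z c)" for z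
    unfolding M_X_def M_Xinv_def fun_eq_iff minus_apply left_diff_distrib by (simp only: mult.assoc mult_1_left simp_thms)
  show "D_X q Q rt lam i (D_Xinv q Q rt lam (Suc i) (emb t z)) - emb t z = emb t (\<lambda>c. ?a c * z c)" for z
    unfolding D_X_emb D_Xinv_emb emb_linear(4)[symmetric] a ..
  show "?a c \<noteq> 0" for c
    unfolding bt_eq[OF t i_range(1)] bt_eq[OF t i_range(2)] right_minus_eq
    by (rule eigenvalue_neq_1[OF t i]) simp_all
  show "(\<lambda>c. ?a c * u c) = (\<kappa> - 1) \<cdot> u"
    unfolding a[symmetric] assms(2) by (simp only: fscale_def fun_eq_iff minus_apply left_diff_distrib mult_1_left simp_thms)
qed (use assms t in simp_all)

lemma inv_into_X_X:
  assumes "u \<in> L_mod q Q rt lam" "X (sg t i) (X (sg t (Suc i)) u) = \<kappa> \<cdot> u" "\<kappa> \<noteq> 1"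
  shows "inv_into (emb t ` L_mod q Q rt lam)
      (\<lambda>w. D_X q Q rt lam i (D_X q Q rt lam (Suc i) w) - w) (emb t u) = inverse (\<kappa> - 1) \<cdot> emb t u"
proof (rule inv_into_emb)
  let ?a = "\<lambda>c. (if c (sg t i) = 0 then bp (sg t i) else bm (sg t i)) *
    (if c (sg t (Suc i)) = 0 then bp (sg t (Suc i)) else bm (sg t (Suc i))) - 1"
  have a: "X (sg t i) (X (sg t (Suc i)) z) - z = (\<lambda>c. ?a c * z c)" for z
    unfolding M_X_def fun_eq_iff minus_apply left_diff_distrib by (simp only: mult.assoc mult_1_left simp_thms)
  show "D_X q Q rt lam i (D_X q Q rt lam (Suc i) (emb t z)) - emb t z = emb t (\<lambda>c. ?a c * z c)" for z
    unfolding D_X_emb emb_linear(4)[symmetric] a ..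
  show "?a c \<noteq> 0" for c
    unfolding bt_eq[OF t i_range(1)] bt_eq[OF t i_range(2)] right_minus_eq
    by (rule eigenvalue_neq_1[OF t i]) simp_all
  show "(\<lambda>c. ?a c * u c) = (\<kappa> - 1) \<cdot> u"
    unfolding a[symmetric] assms(2) by (simp only: fscale_def fun_eq_iff minus_apply left_diff_distrib mult_1_left simp_thms)
qed (use assms t in simp_all)

lemma D_T_on_eigen:
  assumes "u \<in> L_mod q Q rt lam" "X (sg t i) (Xinv (sg t (Suc i)) u) = \<kappa> \<cdot> u" "\<kappa> \<noteq> 1"
    and "M_C (sg t i) (M_C (sg t (Suc i)) u) = r" "r \<in> L_mod q Q rt lam"
      "X (sg t i) (X (sg t (Suc i)) r) = \<kappa>' \<cdot> r" "\<kappa>' \<noteq> 1"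
  shows "D_T_on q Q rt lam i t u = (- (eps q / (\<kappa> - 1))) \<cdot> emb t u + (eps q / (\<kappa>' - 1)) \<cdot> emb t r +
    (std_delta lam (swap_tab i t) * rt (ct q Q rt lam t i)) \<cdot> emb (swap_tab i t) u"
  unfolding D_T_on_def Let_def D_C_emb assms(4) inv_into_X_Xinv[OF assms(1-3)] inv_into_X_X[OF assms(5-7)]
  by (simp only: fscale_simps fun_uminus_scale divide_inverse)

lemma D_T_on_zero: "D_T_on q Q rt lam i t 0 = 0"
proof -
  have z: "0 \<in> L_mod q Q rt lam" by (rule fvec.subspace_0[OF L_mod_closed(1)])
  \<comment> \<open>The zero vector is an eigenvector for any scalar; 0 is a choice different from
    1.\<close>
  have "(0 :: 'k) \<noteq> 1" by simp
  from D_T_on_eigen[OF z _ this _ z _ this]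
  show ?thesis
    by (simp only: M_X_linear M_Xinv_linear M_C_zero fscale_simps emb_linear add_0)
qed

end

text \<open>The sum defining \<open>D_T\<close> collapses, because the other components vanish and
  T_i sends zero to zero.\<close>

lemma D_T_emb:
  assumes "t \<in> Std lam" "1 \<le> i" "Suc i \<le> n"
  shows "D_T q Q rt lam i (emb t z) = D_T_on q Q rt lam i t z"
proof -
  have "(\<Sum>s\<in>Std lam - {t}. D_T_on q Q rt lam i s (part s (emb t z))) = 0"
  proof (rule sum.neutral, rule ballI)
    fix s assume "s \<in> Std lam - {t}"
    then have "s \<in> Std lam" "s \<noteq> t" by simp_all
    then show "D_T_on q Q rt lam i s (part s (emb t z)) = 0"
      using D_T_on_zero[OF _ assms(2,3)] by (simp only: part_emb if_False)
  qed
  then show ?thesis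
    unfolding D_T_def sum.remove[OF finite_Std[OF lam] assms(1)] part_emb by (simp only: if_True simp_thms add_0_right)
qed

text \<open>The inverse permutation of s_i t is that of t followed on the right by s_i, so
  \<open>word_swap\<close> applies to both words. Standardness of s_i t is not assumed: in T_i the
  factor \<open>std_delta\<close> removes the other case.\<close>

lemma W_swap:
  assumes t: "t \<in> Std lam" and "1 \<le> i" "Suc i \<le> n"
  shows "emb (swap_tab i t) (W t \<beta> \<alpha>) =
    (- 1) ^ (delta \<beta> i * delta \<beta> (i + 1) + delta \<alpha> i * delta \<alpha> (i + 1)) \<cdot>
      CCv rt lam (swap_tab i t) (swap_exp i \<beta>) (swap_exp i \<alpha>)"
proof -
  have "inv (transpose i (Suc i) \<circ> dp t) = sg t \<circ> transpose i (Suc i)"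
    using o_inv_distrib[OF bij_transpose bij_dp[OF t]] by simp
  then have sg: "sg (swap_tab i t) = sg t \<circ> transpose i (Suc i)"
    by (simp only: dperm_swap[OF lam assms])
  have "W (swap_tab i t) (swap_exp i \<beta>) (swap_exp i \<alpha>) =
      (- 1) ^ (delta \<beta> i * delta \<beta> (i + 1) + delta \<alpha> i * delta \<alpha> (i + 1)) \<cdot> W t \<beta> \<alpha>"
    unfolding W_def sg
    by (simp only: word_swap[OF inj_sg[OF t] assms(2,3)] word_scale fscale_simps power_add
        Suc_eq_plus1[symmetric] mult.commute[of "(- 1) ^ (delta \<alpha> i * delta \<alpha> (Suc i))"])
  then show ?thesis
    unfolding CCv_emb by (simp only: emb_linear fscale_simps minus_one_mult_self)
qed

text \<open>R is kept as C_i C_{i+1} applied to the vector, which separates the eigenvalue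
  computation from the case distinction on diagonal entries.\<close>

lemma D_T_CCv:
  assumes t: "t \<in> Std lam" and i: "1 \<le> i" "Suc i \<le> n" and \<beta>: "\<beta> \<in> B t" and \<alpha>: "\<alpha> \<in> A t"
  shows "D_T q Q rt lam i (CCv rt lam t \<beta> \<alpha>) =
    (- (eps q / (b t i powi (- nu \<beta> i) * b t (i + 1) powi nu \<beta> (i + 1) - 1))) \<cdot> CCv rt lam t \<beta> \<alpha>
    + (eps q / (b t i powi nu \<beta> i * b t (i + 1) powi nu \<beta> (i + 1) - 1)) \<cdot>
        D_C lam i (D_C lam (i + 1) (CCv rt lam t \<beta> \<alpha>))
    + (std_delta lam (swap_tab i t)
        * (- 1) ^ (delta \<beta> i * delta \<beta> (i + 1) + delta \<alpha> i * delta \<alpha> (i + 1))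
        * rt (ct q Q rt lam t i))
      \<cdot> CCv rt lam (swap_tab i t) (swap_exp i \<beta>) (swap_exp i \<alpha>)"
proof -
  let ?w = "W t \<beta> \<alpha>" and ?i' = "Suc i"
  let ?r = "M_C (sg t i) (M_C (sg t ?i') ?w)"
  note ir = i_range[OF t i]
  have ne: "sg t i \<noteq> sg t ?i'" using inj_eq[OF inj_sg[OF t]] by simp
  have w: "?w \<in> L_mod q Q rt lam" by (rule W_in_L[OF t])
  then have r: "?r \<in> L_mod q Q rt lam"
    by (intro L_mod_closed(3) sg_range[OF t] ir)
  have e1: "X (sg t i) (Xinv (sg t ?i') ?w) = (b t i powi (- nu \<beta> i) * b t ?i' powi nu \<beta> ?i') \<cdot> ?w"
    by (simp only: W_X[OF t \<beta> \<alpha> ir(1)] W_X[OF t \<beta> \<alpha> ir(2)] M_X_linear fscale_simps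
        mult.commute[of "b t ?i' powi nu \<beta> ?i'"])
  \<comment> \<open>Each X is inverted by the C with its own index and commutes with the other one,
    hence the exponents \<nu> without minus sign.\<close>
  have "X (sg t i) (X (sg t ?i') ?r) = M_C (sg t i) (M_C (sg t ?i') (Xinv (sg t i) (Xinv (sg t ?i') ?w)))"
    by (simp only: M_X_M_C_same M_X_M_C_diff[OF ne] M_X_M_C_diff[OF ne[symmetric]] M_Xinv_M_C_diff[OF ne])
  then have e2: "X (sg t i) (X (sg t ?i') ?r) = (b t i powi nu \<beta> i * b t ?i' powi nu \<beta> ?i') \<cdot> ?r"
    by (simp only: W_X[OF t \<beta> \<alpha> ir(1)] W_X[OF t \<beta> \<alpha> ir(2)] M_Xinv_linear M_C_scale fscale_simps
        mult.commute[of "b t ?i' powi nu \<beta> ?i'"])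
  have n1: "b t i powi (- nu \<beta> i) * b t ?i' powi nu \<beta> ?i' \<noteq> 1"
    "b t i powi nu \<beta> i * b t ?i' powi nu \<beta> ?i' \<noteq> 1"
    by (rule eigenvalue_neq_1[OF t i powi_nu(2)[OF t] powi_nu(1)[OF t]],
        rule eigenvalue_neq_1[OF t i powi_nu(1)[OF t] powi_nu(1)[OF t]])
  show ?thesis
    unfolding CCv_emb[of t] D_T_emb[OF t i] D_C_emb D_T_on_eigen[OF t i w e1 n1(1) refl r e2 n1(2)]
      W_swap[OF t i]
    by (simp only: Suc_eq_plus1[symmetric] fscale_simps mult.assoc mult.commute[of "rt (ct q Q rt lam t i)"])
qed

section \<open>Explicit formulas for C_i and C_i C_{i+1} on C^\<beta> C^\<alpha> v_t\<close>

context
  fixes t assumes t: "t \<in> Std lam"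
begin

abbreviation (input) "w \<equiv> CCv rt lam t"
abbreviation (input) "x \<equiv> xp lam t"

lemma D_X_CCv:
  assumes "\<beta> \<in> B t" "\<alpha> \<in> A t" "i \<in> {1..n}"
  shows "D_X q Q rt lam i (w \<beta> \<alpha>) = (b t i powi (- nu \<beta> i)) \<cdot> w \<beta> \<alpha>"
  unfolding CCv_emb D_X_emb W_X(1)[OF t assms] emb_linear ..

lemma D_C_off:
  assumes "\<beta> \<in> B t" "i \<in> {1..n}" "i \<notin> Dtab lam t"
  shows "D_C lam i (w \<beta> \<alpha>) = (- 1) ^ wt \<beta> {..<i} \<cdot> w (\<beta> + evec i) \<alpha>"
  unfolding CCv_emb D_C_emb W_C_off[OF t assms(1) DiffI[OF assms(2,3)]] emb_linear ..

lemma D_C_odd: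
  assumes "\<beta> \<in> B t" "\<alpha> \<in> A t" "p \<in> {1..num_diag lam}" "odd p" "i = x p"
  shows "D_C lam i (w \<beta> \<alpha>) = (- 1) ^ (wt \<beta> UNIV + wt \<alpha> {..<i}) \<cdot> w \<beta> (\<alpha> + evec i)"
  unfolding CCv_emb D_C_emb W_C_odd[OF t assms] emb_linear ..

lemma D_C_even:
  assumes "\<beta> \<in> B t" "\<alpha> \<in> A t" "p \<in> {1..num_diag lam}" "even p" "i = x p"
  shows "D_C lam i (w \<beta> \<alpha>) =
    (- rt (- 1) * (- 1) ^ (wt \<beta> UNIV + wt \<alpha> {..x (p - 1)})) \<cdot> w \<beta> (\<alpha> + evec (x (p - 1)))"
  unfolding CCv_emb D_C_emb W_C_even[OF t assms] emb_linear ..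

lemma D_C_scale: "D_C lam i (c \<cdot> w \<beta> \<alpha>) = c \<cdot> D_C lam i (w \<beta> \<alpha>)"
  unfolding CCv_emb emb_linear(2)[symmetric] D_C_emb M_C_scale ..

lemma A_pred:
  assumes "\<alpha> \<in> A t" "p \<in> {1..num_diag lam}" "even p"
  shows "\<alpha> + evec (x (p - 1)) \<in> A t"
proof (rule evec_A[OF t assms(1)])
  show "p - 1 \<in> {1..num_diag lam}" "odd (p - 1)" using assms(2,3) by (auto elim!: evenE)
qed

lemma CC_off_off:
  assumes \<beta>: "\<beta> \<in> B t" and "i \<in> {1..n}" "i + 1 \<in> {1..n}" "i \<notin> Dtab lam t" "i + 1 \<notin> Dtab lam t"
  shows "D_C lam i (D_C lam (i + 1) (w \<beta> \<alpha>)) =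
    (- 1) ^ delta \<beta> i \<cdot> w (\<beta> + evec i + evec (i + 1)) \<alpha>"
proof -
  have e: "\<beta> + evec (i + 1) + evec i = \<beta> + evec i + evec (i + 1)" by (simp only: ac_simps)
  \<comment> \<open>Adding \<open>evec (i + 1)\<close> does not affect positions below i, so only
    the letter at i is counted once.\<close>
  have "(- 1 :: 'k) ^ (wt \<beta> {..<i + 1} + wt (\<beta> + evec (i + 1)) {..<i}) = (- 1) ^ delta \<beta> i"
    by (rule neg_one_power_cong) (simp add: wt_lessThan_Suc wt_evec_outside del: plus_fun_apply, blast)
  then show ?thesis
    by (simp only: D_C_off[OF \<beta> assms(3,5)] D_C_scale
        D_C_off[OF evec_B[OF t \<beta> assms(3,5)] assms(2,4)] fscale_simps e power_add[symmetric])
qed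

lemma wt_evec_UNIV_parity: "\<beta> \<in> B t \<Longrightarrow> even (wt (\<beta> + evec k) UNIV) \<longleftrightarrow> odd (wt \<beta> UNIV)"
  by (rule wt_evec_parity[OF finite_supp[OF t]]) simp_all

lemma CC_diag_off:
  assumes \<beta>: "\<beta> \<in> B t" and \<alpha>: "\<alpha> \<in> A t" and "i + 1 \<in> {1..n}" "i + 1 \<notin> Dtab lam t"
    and p: "p \<in> {1..num_diag lam}" "i = x p"
  shows "D_C lam i (D_C lam (i + 1) (w \<beta> \<alpha>)) = (if odd p
    then (- 1) ^ (wt \<beta> {i<..} + 1 + wt \<alpha> {..<i}) \<cdot> w (\<beta> + evec (i + 1)) (\<alpha> + evec i)
    else (- rt (- 1) * (- 1) ^ (wt \<beta> {i<..} + 1 + wt \<alpha> {..x (p - 1)}))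
      \<cdot> w (\<beta> + evec (i + 1)) (\<alpha> + evec (x (p - 1))))"
proof -
  have \<beta>': "\<beta> + evec (i + 1) \<in> B t" by (rule evec_B[OF t \<beta> assms(3,4)])
  have "wt \<beta> UNIV = wt \<beta> {..<i + 1} + wt \<beta> {i<..}"
    using wt_UNIV_split(1)[OF finite_supp[OF t \<beta>], of i] by (simp add: lessThan_Suc_atMost)
  \<comment> \<open>C_{i+1} acts first and changes the length of C^\<beta> by one before C_i passes
    it; this is the summand 1. The remaining |\<beta>|_{\<le>i} + |\<beta>| is |\<beta>|_{>i} modulo
    2.\<close>
  then have s: "(- 1 :: 'k) ^ wt \<beta> {..<i + 1} * (- 1) ^ (wt (\<beta> + evec (i + 1)) UNIV + k) =
      (- 1) ^ (wt \<beta> {i<..} + 1 + k)" for k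
    unfolding power_add[symmetric] using wt_evec_UNIV_parity[OF \<beta>, of "i + 1"]
    by (intro neg_one_power_cong) (simp add: even_add del: plus_fun_apply, blast)
  show ?thesis
  proof (cases "odd p")
    case True
    show ?thesis
      by (simp only: D_C_off[OF \<beta> assms(3,4)] D_C_scale D_C_odd[OF \<beta>' \<alpha> p(1) True p(2)]
          fscale_simps s True if_True simp_thms)
  next
    case False
    then have even: "even p" by blast
    show ?thesis
      by (simp only: D_C_off[OF \<beta> assms(3,4)] D_C_scale D_C_even[OF \<beta>' \<alpha> p(1) even p(2)]
          fscale_simps mult.left_commute[of "(- 1) ^ wt \<beta> {..<i + 1}"] s even if_False simp_thms)
  qed
qed

lemma CC_off_diag:
  assumes \<beta>: "\<beta> \<in> B t" and \<alpha>: "\<alpha> \<in> A t" and "i \<in> {1..n}" "i \<notin> Dtab lam t"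
    and p: "p \<in> {1..num_diag lam}" "i + 1 = x p"
  shows "D_C lam i (D_C lam (i + 1) (w \<beta> \<alpha>)) = (if odd p
    then (- 1) ^ (wt \<beta> {i..} + wt \<alpha> {..<i + 1}) \<cdot> w (\<beta> + evec i) (\<alpha> + evec (i + 1))
    else (- rt (- 1) * (- 1) ^ (wt \<beta> {i..} + wt \<alpha> {..x (p - 1)}))
      \<cdot> w (\<beta> + evec i) (\<alpha> + evec (x (p - 1))))"
proof -
  have "wt \<beta> UNIV = wt \<beta> {..<i} + wt \<beta> {i..}"
    by (rule wt_UNIV_split(2)[OF finite_supp[OF t \<beta>]])
  \<comment> \<open>Here C_{i+1} passes the unchanged C^\<beta> and C_i is inserted afterwards, so
    no extra sign arises.\<close>
  then have s: "(- 1 :: 'k) ^ (wt \<beta> UNIV + k) * (- 1) ^ wt \<beta> {..<i} = (- 1) ^ (wt \<beta> {i..} + k)" for k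
    unfolding power_add[symmetric] by (intro neg_one_power_cong) (simp, blast)
  show ?thesis
  proof (cases "odd p")
    case True
    show ?thesis
      by (simp only: D_C_odd[OF \<beta> \<alpha> p(1) True p(2)] D_C_scale D_C_off[OF \<beta> assms(3,4)]
          fscale_simps s True if_True simp_thms)
  next
    case False
    then have even: "even p" by blast
    show ?thesis
      by (simp only: D_C_even[OF \<beta> \<alpha> p(1) even p(2)] D_C_scale D_C_off[OF \<beta> assms(3,4)]
          fscale_simps mult.assoc s even if_False simp_thms)
  qed
qed

lemma CC_diag_diag:
  assumes \<beta>: "\<beta> \<in> B t" and \<alpha>: "\<alpha> \<in> A t"
    and p: "p \<in> {1..num_diag lam}" "i = x p" and p': "p' \<in> {1..num_diag lam}" "i + 1 = x p'"
  shows "D_C lam i (D_C lam (i + 1) (w \<beta> \<alpha>)) = (if odd p \<and> odd p'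
    then (- 1) ^ delta \<alpha> i \<cdot> w \<beta> (\<alpha> + evec i + evec (i + 1))
    else if even p \<and> odd p'
    then (- rt (- 1) * (- 1) ^ (wt \<alpha> {..<i + 1} + wt (\<alpha> + evec (i + 1)) {..x (p - 1)}))
      \<cdot> w \<beta> (\<alpha> + evec (x (p - 1)) + evec (i + 1))
    else if odd p \<and> even p'
    then (- rt (- 1) * (- 1) ^ (wt \<alpha> {..x (p' - 1)} + wt (\<alpha> + evec (x (p' - 1))) {..<i}))
      \<cdot> w \<beta> (\<alpha> + evec i + evec (x (p' - 1)))
    else (- 1) ^ (1 + wt \<alpha> {..x (p' - 1)} + wt (\<alpha> + evec (x (p' - 1))) {..x (p - 1)})
      \<cdot> w \<beta> (\<alpha> + evec (x (p - 1)) + evec (x (p' - 1))))"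
proof -
  have c: "\<alpha> + evec k + evec l = \<alpha> + evec l + evec k" for k l by (simp only: ac_simps)
  \<comment> \<open>Both operators pass the same C^\<beta>, so its contributions cancel.\<close>
  have s: "(- 1 :: 'k) ^ (wt \<beta> UNIV + k) * (- 1) ^ (wt \<beta> UNIV + l) = (- 1) ^ (k + l)" for k l
    unfolding power_add[symmetric] by (intro neg_one_power_cong) (simp, blast)
  \<comment> \<open>Two even indices produce the square of - \<open>rt (-1)\<close>, namely -1; it
    is the 1 in the exponent of the last case.\<close>
  have I: "- rt (- 1) * u * (- rt (- 1) * v) = - (u * v)" for u v
  proof -
    have "- rt (- 1) * u * (- rt (- 1) * v) = (rt (- 1) * rt (- 1)) * (u * v)"
      by (simp add: algebra_simps)
    then show ?thesis by (simp add: rt)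
  qed
  show ?thesis
  proof (cases "odd p'")
    case p'o: True
    have \<alpha>': "\<alpha> + evec (i + 1) \<in> A t"
      unfolding p'(2) by (rule evec_A[OF t \<alpha> p'(1) p'o])
    show ?thesis
    proof (cases "odd p")
      case po: True
      have "(- 1 :: 'k) ^ (wt \<alpha> {..<i + 1} + wt (\<alpha> + evec (i + 1)) {..<i}) = (- 1) ^ delta \<alpha> i"
        by (rule neg_one_power_cong) (simp add: wt_lessThan_Suc wt_evec_outside del: plus_fun_apply, blast)
      then show ?thesis
        by (simp only: D_C_odd[OF \<beta> \<alpha> p'(1) p'o p'(2)] D_C_scale D_C_odd[OF \<beta> \<alpha>' p(1) po p(2)]
            fscale_simps s c[of "i + 1" i] p'o po if_True simp_thms)
    next
      case False
      then have pe: "even p" by blast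
      show ?thesis
        by (simp only: D_C_odd[OF \<beta> \<alpha> p'(1) p'o p'(2)] D_C_scale D_C_even[OF \<beta> \<alpha>' p(1) pe p(2)]
            fscale_simps mult.left_commute[of "(- 1) ^ (wt \<beta> UNIV + wt \<alpha> {..<i + 1})"]
            s c[of "i + 1" "x (p - 1)"] p'o pe if_True if_False simp_thms)
    qed
  next
    case False
    then have p'e: "even p'" by blast
    have \<alpha>': "\<alpha> + evec (x (p' - 1)) \<in> A t" by (rule A_pred[OF \<alpha> p'(1) p'e])
    show ?thesis
    proof (cases "odd p")
      case po: True
      show ?thesis
        by (simp only: D_C_even[OF \<beta> \<alpha> p'(1) p'e p'(2)] D_C_scale D_C_odd[OF \<beta> \<alpha>' p(1) po p(2)]
            fscale_simps mult.assoc s c[of "x (p' - 1)" i] p'e po if_True if_False simp_thms)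
    next
      case False
      then have pe: "even p" by blast
      show ?thesis
        by (simp only: D_C_even[OF \<beta> \<alpha> p'(1) p'e p'(2)] D_C_scale D_C_even[OF \<beta> \<alpha>' p(1) pe p(2)]
            fscale_simps I s c[of "x (p' - 1)" "x (p - 1)"] p'e pe if_False simp_thms)
          (simp only: add.assoc power_add power_one_right mult_minus1)
    qed
  qed
qed

end

section \<open>The basis of the direct sum\<close>

lemma CCv_dual:
  assumes "g \<in> basis_index lam" "h \<in> basis_index lam"
  shows "(case g of (t, \<beta>, \<alpha>) \<Rightarrow> CCv rt lam t \<beta> \<alpha>) (case h of (t, \<beta>, \<alpha>) \<Rightarrow> (t, (\<beta> + \<alpha>) \<circ> dp t)) \<noteq> 0
    \<longleftrightarrow> g = h"
proof -
  obtain t \<beta> \<alpha> t' \<beta>' \<alpha>' where gh: "g = (t, \<beta>, \<alpha>)" "h = (t', \<beta>', \<alpha>')" by (cases g; cases h) blast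
  then have *: "t \<in> Std lam" "\<beta> \<in> B t" "\<alpha> \<in> A t" "t' \<in> Std lam" "\<beta>' \<in> B t'" "\<alpha>' \<in> A t'"
    using assms by (simp_all add: basis_index_def boxes_card(2)[OF lam])
  show ?thesis
  proof (cases "t' = t")
    case True
    have "emb t (W t \<beta> \<alpha>) (t, (\<beta>' + \<alpha>') \<circ> dp t) \<noteq> 0 \<longleftrightarrow> \<beta> = \<beta>' \<and> \<alpha> = \<alpha>'"
      using W_dual[OF *(1,2,3)] *(5,6) unfolding True emb_def by simp
    then show ?thesis unfolding gh True CCv_emb by simp
  next
    \<comment> \<open>The test point lies in another summand, where the vector is zero.\<close>
    case False
    then show ?thesis unfolding gh CCv_emb emb_def by simp
  qed
qed

lemma CCv_independent:
  "inj_on (\<lambda>(t, \<beta>, \<alpha>). CCv rt lam t \<beta> \<alpha>) (basis_index lam)"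
  "fvec.independent ((\<lambda>(t, \<beta>, \<alpha>). CCv rt lam t \<beta> \<alpha>) ` basis_index lam)"
  by (rule dual_independent[where f = "\<lambda>(t, \<beta>, \<alpha>). CCv rt lam t \<beta> \<alpha>"
        and pos = "\<lambda>(t, \<beta>, \<alpha>). (t, (\<beta> + \<alpha>) \<circ> dp t)", OF CCv_dual]; assumption)+

lemma D_mod_subspace: "fvec.subspace (D_mod q Q rt lam)"
proof -
  have p: "part t 0 = 0" "part t (F + G) = part t F + part t G" "part t (c \<cdot> F) = c \<cdot> part t F"
    for t and F G :: "'k dvec" and c
    by (simp_all add: part_def fun_eq_iff fscale_def)
  have D: "F \<in> D_mod q Q rt lam \<longleftrightarrow>
      (\<forall>t\<in>Std lam. part t F \<in> L_mod q Q rt lam) \<and> (\<forall>t. t \<notin> Std lam \<longrightarrow> part t F = 0)" for F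
    by (auto simp: D_mod_def)
  then have D1: "F \<in> D_mod q Q rt lam \<Longrightarrow> t \<in> Std lam \<Longrightarrow> part t F \<in> L_mod q Q rt lam"
    and D2: "F \<in> D_mod q Q rt lam \<Longrightarrow> t \<notin> Std lam \<Longrightarrow> part t F = 0" for F t
    by blast+
  note L = L_mod_closed(1)
  show ?thesis
    unfolding fvec.subspace_def D[of "_ + _"] D[of "_ \<cdot> _"] D[of 0] p
    by (intro conjI ballI allI impI fvec.subspace_0[OF L] fvec.subspace_add[OF L] fvec.subspace_scale[OF L])
      (simp_all only: D1 D2 fscale_simps add_0_left simp_thms)
qed

lemma D_mod_eq_span:
  "D_mod q Q rt lam = fvec.span ((\<lambda>(t, \<beta>, \<alpha>). CCv rt lam t \<beta> \<alpha>) ` basis_index lam)"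
    (is "_ = fvec.span ?G")
proof
  show "fvec.span ?G \<subseteq> D_mod q Q rt lam"
  proof (rule fvec.span_minimal[OF _ D_mod_subspace], rule image_subsetI)
    fix g assume "g \<in> basis_index lam"
    then obtain t \<beta> \<alpha> where g: "g = (t, \<beta>, \<alpha>)" "t \<in> Std lam"
      unfolding basis_index_def by blast
    have "emb t (W t \<beta> \<alpha>) \<in> D_mod q Q rt lam"
      unfolding D_mod_def mem_Collect_eq part_emb
      using W_in_L[OF g(2)] g(2) fvec.subspace_0[OF L_mod_closed(1)] by metis
    then show "(case g of (t, \<beta>, \<alpha>) \<Rightarrow> CCv rt lam t \<beta> \<alpha>) \<in> D_mod q Q rt lam"
      unfolding g(1) CCv_emb prod.case .
  qed
  show "D_mod q Q rt lam \<subseteq> fvec.span ?G"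
  proof
    fix F assume F: "F \<in> D_mod q Q rt lam"
    have "emb t (part t F) \<in> fvec.span ?G" if t: "t \<in> Std lam" for t
    proof (rule span_closed[where T = "emb t", OF emb_linear(1-3)])
      show "part t F \<in> fvec.span ((\<lambda>(\<beta>, \<alpha>). W t \<beta> \<alpha>) ` (B t \<times> A t))"
        using F t unfolding D_mod_def L_mod_eq_span[OF t, symmetric] by simp
      fix z assume "z \<in> (\<lambda>(\<beta>, \<alpha>). W t \<beta> \<alpha>) ` (B t \<times> A t)"
      then obtain \<beta> \<alpha> where z: "z = W t \<beta> \<alpha>" "\<beta> \<in> B t" "\<alpha> \<in> A t" by force
      then have "(t, \<beta>, \<alpha>) \<in> basis_index lam"
        using t by (simp add: basis_index_def boxes_card(2)[OF lam])
      then have "CCv rt lam t \<beta> \<alpha> \<in> ?G" by force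
      then show "emb t z \<in> fvec.span ?G" unfolding z(1) CCv_emb[symmetric] by (rule fvec.span_base)
    qed
    \<comment> \<open>F is the finite sum of its components, each of which lies in the span of its
      own summand.\<close>
    then have "(\<Sum>t\<in>Std lam. emb t (part t F)) \<in> fvec.span ?G" by (rule fvec.span_sum)
    moreover have "(\<Sum>t\<in>Std lam. emb t (part t F)) (s, c) = F (s, c)" for s c
    proof -
      have "(\<Sum>t\<in>Std lam. emb t (part t F)) (s, c) = (\<Sum>t\<in>Std lam. if s = t then F (t, c) else 0)"
        unfolding sum_fun_eval emb_def part_def by (simp only: prod.case)
      also have "\<dots> = (if s \<in> Std lam then F (s, c) else 0)"
        by (rule sum.delta'[OF finite_Std[OF lam]])
      also have "\<dots> = F (s, c)"
      proof (cases "s \<in> Std lam")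
        case False
        then have "part s F = 0" using F unfolding D_mod_def by auto
        then have "F (s, c) = 0" unfolding part_def fun_eq_iff by simp
        then show ?thesis using False by simp
      qed simp
      finally show ?thesis .
    qed
    then have "(\<Sum>t\<in>Std lam. emb t (part t F)) = F" by (intro ext) (metis surj_pair)
    ultimately show "F \<in> fvec.span ?G" by simp
  qed
qed

end

section \<open>The basis theorem with the action of the generators\<close>

theorem theorem1p1:
  fixes q :: "'k::alg_closed_field"
    and Q :: "nat \<Rightarrow> 'k"
    and rt :: "'k \<Rightarrow> 'k"
    and bul :: bullet
    and m n :: nat
    and lam :: mpart
  assumes "CHAR('k) \<noteq> 2"
    and "\<forall>a. (rt a)\<^sup>2 = a"
    and "n \<ge> 1"
    and "q \<noteq> 0" and "q\<^sup>2 \<noteq> 1" and "q\<^sup>2 \<noteq> -1"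
    and "\<forall>i\<in>{1..m}. Q i \<noteq> 0"
    and "\<forall>mu\<in>mparts bul m (n + 1). separate q Q mu"
    and "lam \<in> mparts bul m n"
  shows
    "inj_on (\<lambda>(t, \<beta>, \<alpha>). CCv rt lam t \<beta> \<alpha>) (basis_index lam)
     \<and> fvec.independent ((\<lambda>(t, \<beta>, \<alpha>). CCv rt lam t \<beta> \<alpha>) ` basis_index lam)
     \<and> fvec.span ((\<lambda>(t, \<beta>, \<alpha>). CCv rt lam t \<beta> \<alpha>) ` basis_index lam) = D_mod q Q rt lam
     \<and> (\<forall>t\<in>Std lam. \<forall>\<beta>\<in>Z2 ({1..n} - Dtab lam t). \<forall>\<alpha>\<in>Z2 (ODtab lam t).
        let w = CCv rt lam t; b = bt q Q rt lam t; D = Dtab lam t; x = xp lam t;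
            P = {1..num_diag lam}; sqrtm1 = rt (-1)
        in
          (\<forall>i\<in>{1..n}. D_X q Q rt lam i (w \<beta> \<alpha>) = (b i powi (- nu \<beta> i)) \<cdot> w \<beta> \<alpha>)
        \<and> (\<forall>i\<in>{1..n}.
             (i \<notin> D \<longrightarrow>
               D_C lam i (w \<beta> \<alpha>) = (-1) ^ wt \<beta> {..<i} \<cdot> w (\<beta> + evec i) \<alpha>)
           \<and> (\<forall>p\<in>P. i = x p \<and> odd p \<longrightarrow>
               D_C lam i (w \<beta> \<alpha>) = (-1) ^ (wt \<beta> UNIV + wt \<alpha> {..<i}) \<cdot> w \<beta> (\<alpha> + evec i))
           \<and> (\<forall>p\<in>P. i = x p \<and> even p \<longrightarrow>
               D_C lam i (w \<beta> \<alpha>) =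
                 (- sqrtm1 * (-1) ^ (wt \<beta> UNIV + wt \<alpha> {..x (p - 1)})) \<cdot> w \<beta> (\<alpha> + evec (x (p - 1)))))
        \<and> (\<forall>i\<in>{1..n - 1}.
             let T_eq = (\<lambda>R. D_T q Q rt lam i (w \<beta> \<alpha>) =
                   (- (eps q / (b i powi (- nu \<beta> i) * b (i + 1) powi nu \<beta> (i + 1) - 1))) \<cdot> w \<beta> \<alpha>
                   + (eps q / (b i powi nu \<beta> i * b (i + 1) powi nu \<beta> (i + 1) - 1)) \<cdot> R
                   + (std_delta lam (swap_tab i t)
                        * (-1) ^ (delta \<beta> i * delta \<beta> (i + 1) + delta \<alpha> i * delta \<alpha> (i + 1))
                        * rt (ct q Q rt lam t i))
                       \<cdot> CCv rt lam (swap_tab i t) (swap_exp i \<beta>) (swap_exp i \<alpha>))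
             in
               (i \<notin> D \<and> i + 1 \<notin> D \<longrightarrow>
                 T_eq ((-1) ^ delta \<beta> i \<cdot> w (\<beta> + evec i + evec (i + 1)) \<alpha>))
             \<and> (\<forall>p\<in>P. i = x p \<and> i + 1 \<notin> D \<longrightarrow>
                 T_eq (if odd p
                   then (-1) ^ (wt \<beta> {i<..} + 1 + wt \<alpha> {..<i}) \<cdot> w (\<beta> + evec (i + 1)) (\<alpha> + evec i)
                   else (- sqrtm1 * (-1) ^ (wt \<beta> {i<..} + 1 + wt \<alpha> {..x (p - 1)}))
                          \<cdot> w (\<beta> + evec (i + 1)) (\<alpha> + evec (x (p - 1)))))
             \<and> (\<forall>p\<in>P. i \<notin> D \<and> i + 1 = x p \<longrightarrow>
                 T_eq (if odd p
                   then (-1) ^ (wt \<beta> {i..} + wt \<alpha> {..<i + 1}) \<cdot> w (\<beta> + evec i) (\<alpha> + evec (i + 1))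
                   else (- sqrtm1 * (-1) ^ (wt \<beta> {i..} + wt \<alpha> {..x (p - 1)}))
                          \<cdot> w (\<beta> + evec i) (\<alpha> + evec (x (p - 1)))))
             \<and> (\<forall>p\<in>P. \<forall>p'\<in>P. i = x p \<and> i + 1 = x p' \<longrightarrow>
                 T_eq (if odd p \<and> odd p'
                   then (-1) ^ delta \<alpha> i \<cdot> w \<beta> (\<alpha> + evec i + evec (i + 1))
                   else if even p \<and> odd p'
                   then (- sqrtm1 * (-1) ^ (wt \<alpha> {..<i + 1} + wt (\<alpha> + evec (i + 1)) {..x (p - 1)}))
                          \<cdot> w \<beta> (\<alpha> + evec (x (p - 1)) + evec (i + 1))
                   else if odd p \<and> even p'
                   then (- sqrtm1 * (-1) ^ (wt \<alpha> {..x (p' - 1)} + wt (\<alpha> + evec (x (p' - 1))) {..<i}))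
                          \<cdot> w \<beta> (\<alpha> + evec i + evec (x (p' - 1)))
                   else (-1) ^ (1 + wt \<alpha> {..x (p' - 1)} + wt (\<alpha> + evec (x (p' - 1))) {..x (p - 1)})
                          \<cdot> w \<beta> (\<alpha> + evec (x (p - 1)) + evec (x (p' - 1)))))))"
proof -
  have two: "(2 :: 'k) \<noteq> 0" by (rule two_neq_zero[OF assms(1)])
  interpret separate_module q Q rt bul m n lam
    by unfold_locales (use assms two in \<open>simp_all add: power2_eq_square\<close>)
  have r: "1 \<le> i" "Suc i \<le> n" "i \<in> {1..n}" "i + 1 \<in> {1..n}" if "i \<in> {1..n - 1}" for i
    using that n by auto
  show ?thesis
    unfolding Let_def
  proof (intro conjI ballI impI, goal_cases)
    case 1
    show ?case by (rule CCv_independent(1))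
  next
    case 2
    show ?case by (rule CCv_independent(2))
  next
    case 3
    show ?case by (rule D_mod_eq_span[symmetric])
  next
    case (4 t \<beta> \<alpha> i)
    then show ?case by (rule D_X_CCv)
  next
    case (5 t \<beta> \<alpha> i)
    then show ?case by (intro D_C_off)
  next
    case (6 t \<beta> \<alpha> i p)
    then show ?case by (intro D_C_odd) blast+
  next
    case (7 t \<beta> \<alpha> i p)
    then show ?case by (intro D_C_even) blast+
  next
    case (8 t \<beta> \<alpha> i)
    \<comment> \<open>In this and the remaining cases T_i is expanded by \<open>D_T_CCv\<close>, and
      the lemma for the matching position of i and i + 1 evaluates C_i C_{i+1}.\<close>
    show ?case
      unfolding D_T_CCv[OF 8(1) r(1,2)[OF 8(4)] 8(2,3)]
        CC_off_off[OF 8(1,2) r(3,4)[OF 8(4)] conjunct1[OF 8(5)] conjunct2[OF 8(5)]] ..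
  next
    case (9 t \<beta> \<alpha> i p)
    show ?case
      unfolding D_T_CCv[OF 9(1) r(1,2)[OF 9(4)] 9(2,3)]
        CC_diag_off[OF 9(1-3) r(4)[OF 9(4)] conjunct2[OF 9(6)] 9(5) conjunct1[OF 9(6)]] ..
  next
    case (10 t \<beta> \<alpha> i p)
    show ?case
      unfolding D_T_CCv[OF 10(1) r(1,2)[OF 10(4)] 10(2,3)]
        CC_off_diag[OF 10(1-3) r(3)[OF 10(4)] conjunct1[OF 10(6)] 10(5) conjunct2[OF 10(6)]] ..
  next
    case (11 t \<beta> \<alpha> i p p')
    show ?case
      unfolding D_T_CCv[OF 11(1) r(1,2)[OF 11(4)] 11(2,3)]
        CC_diag_diag[OF 11(1-3) 11(5) conjunct1[OF 11(7)] 11(6) conjunct2[OF 11(7)]] ..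
  qed
qed

end
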